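(* Let $\Phi$ be a commutative ring with unity $1\neq 0$, and let $\Delta$ be a basic set of derivation operators containing at least two elements. Then the ideal membership problem for differential polynomial algebras $\Phi\{x_1,\ldots,x_n\}$ (with respect to $\Delta$) is algorithmically undecidable: there is no algorithm which, for every finite sequence of differential polynomials $f,f_1,\ldots,f_k\in\Phi\{x_1,\ldots,x_n\}$, determines whether $f$ belongs to the differential ideal generated by $f_1,\ldots,f_k$.
   Context: $\Delta=\{\delta_1,\ldots,\delta_m\}$ is a set of symbols for commuting derivations. $\Phi$ is regarded as a differential ring on which all $\delta_i$ act as zero. The differential polynomial ring $\Phi\{x_1,\ldots,x_n\}$ is the polynomial ring over $\Phi$ in the algebraically independent variables $\theta(x_i)$, where $1\le i\le n$ and $\theta=\delta_1^{j_1}\cdots\delta_m^{j_m}$ ranges over the free commutative monoid generated by $\Delta$; each $\delta_l$ acts as the unique derivation with $\delta_l(\theta(x_i))=(\delta_l\theta)(x_i)$ and $\delta_l(\Phi)=0$. A differential ideal is an ideal closed under all $\delta_l$; the differential ideal generated by a set is the smallest such ideal containing it. *)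

theory Defs
  imports Main "HOL-Library.Poly_Mapping" "HOL-Library.Nat_Bijection"
begin

text \<open>A derivative operator theta = delta_0^j_0 ... delta_(m-1)^j_(m-1) is an exponent
  vector nat =>0 nat (finitely supported).  The differential indeterminate theta(x_i) is the
  pair (i, theta).  Differential polynomials over the coefficient ring 'a are finitely supported
  maps from monomials (var =>0 nat) to coefficients, i.e. ordinary polynomials in the
  algebraically independent variables theta(x_i).  The derivation symbols are
  delta_0, ..., delta_(m-1) and the differential indeterminates are x_0, ..., x_(n-1).\<close>

type_synonym dvar = "nat \<times> (nat \<Rightarrow>\<^sub>0 nat)"
type_synonym 'a dpoly = "(dvar \<Rightarrow>\<^sub>0 nat) \<Rightarrow>\<^sub>0 'a"

definition shift_var :: "nat \<Rightarrow> dvar \<Rightarrow> dvar" where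
  "shift_var l v = (fst v, snd v + Poly_Mapping.single l 1)"

text \<open>The derivation delta_l: the unique derivation with delta_l(theta x_i) = (delta_l theta) x_i
  and delta_l(Phi) = 0, written out by the Leibniz rule on monomials.\<close>
definition deriv_l :: "nat \<Rightarrow> 'a::comm_ring_1 dpoly \<Rightarrow> 'a dpoly" where
  "deriv_l l p = (\<Sum>t\<in>Poly_Mapping.keys p. \<Sum>v\<in>Poly_Mapping.keys (t :: dvar \<Rightarrow>\<^sub>0 nat).
      Poly_Mapping.single (t - Poly_Mapping.single v 1 + Poly_Mapping.single (shift_var l v) 1)
        (Poly_Mapping.lookup p t * of_nat (Poly_Mapping.lookup t v)))"

definition dpolys :: "nat \<Rightarrow> nat \<Rightarrow> 'a::comm_ring_1 dpoly set" where
  "dpolys n m = {p. \<forall>t\<in>Poly_Mapping.keys p. \<forall>v\<in>Poly_Mapping.keys t. fst v < n \<and> Poly_Mapping.keys (snd v) \<subseteq> {..<m}}"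

definition is_diff_ideal :: "nat \<Rightarrow> nat \<Rightarrow> 'a::comm_ring_1 dpoly set \<Rightarrow> bool" where
  "is_diff_ideal n m I \<longleftrightarrow> I \<subseteq> dpolys n m \<and> 0 \<in> I
     \<and> (\<forall>a\<in>I. \<forall>b\<in>I. a + b \<in> I)
     \<and> (\<forall>a\<in>I. \<forall>r\<in>dpolys n m. r * a \<in> I)
     \<and> (\<forall>a\<in>I. \<forall>l<m. deriv_l l a \<in> I)"

definition diff_ideal_gen :: "nat \<Rightarrow> nat \<Rightarrow> 'a::comm_ring_1 dpoly set \<Rightarrow> 'a dpoly set" where
  "diff_ideal_gen n m F = \<Inter>{I. is_diff_ideal n m I \<and> F \<subseteq> I}"

datatype recf = Zero | Succ | Proj nat | Comp recf "recf list" | PrimRec recf recf | Mn recf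

inductive eval_recf :: "recf \<Rightarrow> nat list \<Rightarrow> nat \<Rightarrow> bool" where
  "eval_recf Zero xs 0"
| "eval_recf Succ (x # xs) (Suc x)"
| "i < length xs \<Longrightarrow> eval_recf (Proj i) xs (xs ! i)"
| "length ys = length gs \<Longrightarrow> (\<forall>i<length gs. eval_recf (gs ! i) xs (ys ! i))
     \<Longrightarrow> eval_recf f ys z \<Longrightarrow> eval_recf (Comp f gs) xs z"
| "eval_recf f xs z \<Longrightarrow> eval_recf (PrimRec f g) (0 # xs) z"
| "eval_recf (PrimRec f g) (k # xs) r \<Longrightarrow> eval_recf g (k # r # xs) z
     \<Longrightarrow> eval_recf (PrimRec f g) (Suc k # xs) z"
| "eval_recf f (k # xs) 0 \<Longrightarrow> (\<forall>j<k. \<exists>v. eval_recf f (j # xs) v \<and> v \<noteq> 0)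
     \<Longrightarrow> eval_recf (Mn f) xs k"

definition decidable_set :: "nat set \<Rightarrow> bool" where
  "decidable_set A \<longleftrightarrow> (\<exists>f. \<forall>x. eval_recf f [x] (if x \<in> A then 1 else 0))"

text \<open>Every natural number codes a differential polynomial with coefficients from the image
  of the integers in Phi (explicit, computable Cantor-style decoding).\<close>

definition decode_theta :: "nat \<Rightarrow> nat \<Rightarrow>\<^sub>0 nat" where
  "decode_theta c = (let js = list_decode c in \<Sum>l<length js. Poly_Mapping.single l (js ! l))"

definition decode_var :: "nat \<Rightarrow> dvar" where
  "decode_var c = (fst (prod_decode c), decode_theta (snd (prod_decode c)))"

definition decode_mono :: "nat \<Rightarrow> dvar \<Rightarrow>\<^sub>0 nat" where
  "decode_mono c = sum_list (map (\<lambda>d. Poly_Mapping.single (decode_var (fst (prod_decode d)))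
                                      (snd (prod_decode d))) (list_decode c))"

definition decode_dpoly :: "nat \<Rightarrow> 'a::comm_ring_1 dpoly" where
  "decode_dpoly c = sum_list (map (\<lambda>d. Poly_Mapping.single (decode_mono (snd (prod_decode d)))
                                      (of_int (int_decode (fst (prod_decode d))))) (list_decode c))"

definition membership_problem :: "'a::comm_ring_1 itself \<Rightarrow> nat \<Rightarrow> nat \<Rightarrow> nat set" where
  "membership_problem _ n m = {x.
     let f = (decode_dpoly (fst (prod_decode x)) :: 'a dpoly);
         fs = map (decode_dpoly :: nat \<Rightarrow> 'a dpoly) (list_decode (snd (prod_decode x)))
     in f \<in> dpolys n m \<and> set fs \<subseteq> dpolys n m \<and> f \<in> diff_ideal_gen n m (set fs)}"

end

theory Submission
  imports Defs "HOL-Computational_Algebra.Primes" "HOL-Library.Infinite_Set"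
begin

text \<open>A configuration of a machine with two counters, in state \<open>q\<close> and with counter values \<open>i\<close> and
  \<open>j\<close>, is encoded by the monomial \<open>st(q) w0 w1 x_ij\<close>, where \<open>x_ij\<close> is the derivative
  \<open>delta_0^i delta_1^j x\<close> and \<open>st(q)\<close> is a product of variables with vanishing derivatives.
  Adding to or subtracting from the counters is a relation linear in \<open>x\<close>, whose derivatives are again
  instances of the same instruction.  An instruction for an exact value of the first counter is multiplied
  by \<open>w0\<close>.  Its derivatives do no harm: the functional sending
  \<open>st(q) (delta_0^a w0) (delta_1^b w1) x_ij\<close> to \<open>(-1)^(a+b) chi(q, i+a, j+b)\<close> annihilates all total
  derivatives of \<open>w0 x\<close> and \<open>w1 x\<close>, so it vanishes on the whole differential ideal as soon as
  \<open>chi\<close> is invariant under the steps of the machine; take for \<open>chi\<close> the indicator of the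
  configurations from which the machine halts.

  Seven differential indeterminates suffice for all machines, since states are told apart by exponents.
  Hence no universal machine is needed: if membership were decidable, the set of all \<open>x\<close> for which the
  query built from \<open>x\<close> and the generators coded by \<open>x\<close> has a negative answer would be decidable
  and thus be represented by the generators with some code \<open>y\<close>, which is contradictory at \<open>x = y\<close>.\<close>

section \<open>From recursive functions to loop programs\<close>

datatype cmd = Skip | Inc nat | Seq cmd cmd | Loop nat cmd

text \<open>A loop decrements its register before each pass, and the body may raise it again, so
  \<open>Loop\<close> is a while loop and not a bounded iteration. Unbounded search relies on
  this.\<close>

inductive exec :: "cmd \<Rightarrow> (nat \<Rightarrow> nat) \<Rightarrow> (nat \<Rightarrow> nat) \<Rightarrow> bool" where
  exec_Skip: "exec Skip \<sigma> \<sigma>"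
| exec_Inc: "exec (Inc r) \<sigma> (\<sigma>(r := Suc (\<sigma> r)))"
| exec_Seq: "exec c \<sigma> \<sigma>' \<Longrightarrow> exec d \<sigma>' \<sigma>'' \<Longrightarrow> exec (Seq c d) \<sigma> \<sigma>''"
| exec_Loop0: "\<sigma> r = 0 \<Longrightarrow> exec (Loop r c) \<sigma> \<sigma>"
| exec_LoopS: "\<sigma> r = Suc k \<Longrightarrow> exec c (\<sigma>(r := k)) \<sigma>' \<Longrightarrow> exec (Loop r c) \<sigma>' \<sigma>''
    \<Longrightarrow> exec (Loop r c) \<sigma> \<sigma>''"

text \<open>The main loops below run along stores known in closed form. With the trajectory
  \<open>S\<close> given in advance, correctness reduces to a single pass of the body.\<close>

lemma exec_Loop_chain:
  assumes "\<And>j. j < n \<Longrightarrow> S j r > 0 \<and> exec c ((S j)(r := S j r - 1)) (S (Suc j))"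
    and "S n r = 0"
  shows "exec (Loop r c) (S 0) (S n)"
  using assms
proof (induction n arbitrary: S)
  case 0
  then show ?case by (auto intro: exec_Loop0)
next
  case (Suc n)
  have "exec (Loop r c) (S (Suc 0)) (S (Suc n))"
    using Suc.IH[of "\<lambda>j. S (Suc j)"] Suc.prems by auto
  moreover have "S 0 r = Suc (S 0 r - 1)" "exec c ((S 0)(r := S 0 r - 1)) (S (Suc 0))"
    using Suc.prems(1)[OF zero_less_Suc] by (simp_all del: fun_upd_apply)
  ultimately show ?case by (metis exec_LoopS)
qed

lemma exec_clear: "exec (Loop r Skip) \<sigma> (\<sigma>(r := 0))"
proof -
  have "exec (Loop r Skip) (\<sigma>(r := \<sigma> r - 0)) (\<sigma>(r := \<sigma> r - \<sigma> r))"
    by (rule exec_Loop_chain[where S = "\<lambda>j. \<sigma>(r := \<sigma> r - j)"]) (auto intro: exec.intros)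
  then show ?thesis by simp
qed

lemma exec_move:
  assumes "a \<noteq> b"
  shows "exec (Loop a (Inc b)) \<sigma> (\<sigma>(a := 0, b := \<sigma> b + \<sigma> a))"
proof -
  let ?S = "\<lambda>j. \<sigma>(a := \<sigma> a - j, b := \<sigma> b + j)"
  have "exec (Loop a (Inc b)) (?S 0) (?S (\<sigma> a))"
  proof (rule exec_Loop_chain[where S = ?S])
    fix j assume j: "j < \<sigma> a"
    have "?S (Suc j) = ((?S j)(a := ?S j a - 1))(b := Suc (((?S j)(a := ?S j a - 1)) b))"
      using assms by (auto simp: fun_eq_iff)
    then show "?S j a > 0 \<and> exec (Inc b) ((?S j)(a := ?S j a - 1)) (?S (Suc j))"
      using j assms exec_Inc[of b "(?S j)(a := ?S j a - 1)"] by auto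
  qed (use assms in auto)
  then show ?thesis using assms by (simp add: fun_upd_twist)
qed

text \<open>A loop destroys the register it reads, so the value goes to \<open>b\<close> and
  \<open>t\<close> at once and is then restored from \<open>t\<close>.\<close>

definition copy :: "nat \<Rightarrow> nat \<Rightarrow> nat \<Rightarrow> cmd" where
  "copy a b t = Seq (Loop a (Seq (Inc b) (Inc t))) (Loop t (Inc a))"

lemma exec_copy:
  assumes "a \<noteq> b" "a \<noteq> t" "b \<noteq> t" "\<sigma> t = 0"
  shows "exec (copy a b t) \<sigma> (\<sigma>(b := \<sigma> b + \<sigma> a))"
proof -
  let ?S = "\<lambda>j. \<sigma>(a := \<sigma> a - j, b := \<sigma> b + j, t := j)"
  have 1: "exec (Loop a (Seq (Inc b) (Inc t))) (?S 0) (?S (\<sigma> a))"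
  proof (rule exec_Loop_chain[where S = ?S])
    fix j assume j: "j < \<sigma> a"
    let ?u = "(?S j)(a := ?S j a - 1)"
    let ?v = "?u(b := Suc (?u b))"
    have "?S (Suc j) = ?v(t := Suc (?v t))"
      using assms by (auto simp: fun_eq_iff)
    then show "?S j a > 0 \<and> exec (Seq (Inc b) (Inc t)) ?u (?S (Suc j))"
      using j assms exec_Seq[OF exec_Inc[of b ?u] exec_Inc[of t ?v]] by auto
  qed (use assms in auto)
  have S0: "?S 0 = \<sigma>" using assms by (auto simp: fun_eq_iff)
  have "(?S (\<sigma> a))(t := 0, a := ?S (\<sigma> a) a + ?S (\<sigma> a) t) = \<sigma>(b := \<sigma> b + \<sigma> a)"
    using assms by (auto simp: fun_eq_iff)
  then show ?thesis
    unfolding copy_def using exec_Seq[OF 1[unfolded S0] exec_move[of t a]] assms by metis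
qed

fun seqs :: "cmd list \<Rightarrow> cmd" where
  "seqs [] = Skip"
| "seqs (c # cs) = Seq c (seqs cs)"

lemma exec_seqs_chain:
  assumes "\<And>j. j < length cs \<Longrightarrow> exec (cs ! j) (S j) (S (Suc j))"
  shows "exec (seqs cs) (S 0) (S (length cs))"
  using assms
proof (induction cs arbitrary: S)
  case Nil
  then show ?case by (auto intro: exec_Skip)
next
  case (Cons c cs)
  have "exec (seqs cs) (S (Suc 0)) (S (Suc (length cs)))"
    using Cons.IH[of "\<lambda>j. S (Suc j)"] Cons.prems by fastforce
  then show ?case using Cons.prems[of 0] by (auto intro: exec_Seq)
qed

text \<open>The inputs are read from \<open>ins\<close>; the registers from \<open>fr\<close> on are scratch.\<close>
function comp_recf :: "recf \<Rightarrow> nat list \<Rightarrow> nat \<Rightarrow> nat \<Rightarrow> cmd" where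
  "comp_recf Zero ins out fr = Skip"
| "comp_recf Succ ins out fr = Seq (copy (hd ins) out fr) (Inc out)"
| "comp_recf (Proj i) ins out fr = copy (ins ! i) out fr"
| "comp_recf (Comp f gs) ins out fr =
     Seq (seqs (map (\<lambda>(j, g). comp_recf g ins (fr + j) (fr + length gs)) (zip [0..<length gs] gs)))
    (Seq (comp_recf f [fr..<fr + length gs] out (fr + length gs))
         (seqs (map (\<lambda>j. Loop (fr + j) Skip) [0..<length gs])))"
| "comp_recf (PrimRec f g) ins out fr =
     Seq (copy (hd ins) fr (fr + 3))
    (Seq (comp_recf f (tl ins) out (fr + 3))
    (Seq (Loop fr (Seq (comp_recf g ((fr + 1) # out # tl ins) (fr + 2) (fr + 3))
                  (Seq (Loop out Skip) (Seq (Loop (fr + 2) (Inc out)) (Inc (fr + 1))))))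
         (Loop (fr + 1) Skip)))"
| "comp_recf (Mn f) ins out fr =
     Seq (Inc fr) (Loop fr (Seq (comp_recf f (out # ins) (fr + 1) (fr + 2))
       (Loop (fr + 1) (Seq (Loop (fr + 1) Skip) (Seq (Inc out) (Inc fr))))))"
  by pat_completeness auto
termination
  by (relation "measure (size \<circ> fst)")
    (auto dest!: set_zip_rightD simp: less_Suc_eq_le intro: size_list_estimation' trans_le_add1)

inductive_cases eval_ZeroE: "eval_recf Zero xs z"
inductive_cases eval_SuccE: "eval_recf Succ xs z"
inductive_cases eval_ProjE: "eval_recf (Proj i) xs z"
inductive_cases eval_CompE: "eval_recf (Comp f gs) xs z"
inductive_cases eval_PrimRecE: "eval_recf (PrimRec f g) xs z"
inductive_cases eval_MnE: "eval_recf (Mn f) xs z"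

text \<open>Unrolls the recursion into the sequence \<open>r\<close> of intermediate values, from
  which the trajectory of the compiled loop is built.\<close>

lemma eval_PrimRec_chain:
  assumes "eval_recf (PrimRec f g) (k # xs) z"
  shows "\<exists>r. eval_recf f xs (r 0) \<and> (\<forall>j<k. eval_recf g (j # r j # xs) (r (Suc j))) \<and> r k = z"
  using assms
proof (induction k arbitrary: z)
  case 0
  then show ?case by (auto elim!: eval_PrimRecE intro!: exI[of _ "\<lambda>_. z"])
next
  case (Suc k)
  then obtain q where q: "eval_recf (PrimRec f g) (k # xs) q" "eval_recf g (k # q # xs) z"
    by (auto elim: eval_PrimRecE)
  from Suc.IH[OF q(1)] obtain r where "eval_recf f xs (r 0)"
    "\<forall>j<k. eval_recf g (j # r j # xs) (r (Suc j))" "r k = q" by auto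
  with q(2) show ?case
    by (intro exI[of _ "\<lambda>j. if j = Suc k then z else r j"]) (auto simp: less_Suc_eq)
qed

lemma eval_PrimRec_nonempty: "eval_recf (PrimRec f g) xs z \<Longrightarrow> xs \<noteq> []"
  by (auto elim: eval_PrimRecE)

text \<open>Since the final store differs from the initial one only in \<open>out\<close>, the
  scratch registers are zero again afterwards. Hence the induction hypotheses apply to subprograms
  that share one scratch area.\<close>

lemma exec_comp_recf:
  assumes "eval_recf f xs z" "map \<sigma> ins = xs" "set ins \<subseteq> {..<fr}" "out < fr" "out \<notin> set ins"
    "\<And>r. r \<ge> fr \<Longrightarrow> \<sigma> r = 0" "\<sigma> out = 0"
  shows "exec (comp_recf f ins out fr) \<sigma> (\<sigma>(out := z))"
  using assms
proof (induction f arbitrary: xs z \<sigma> ins out fr)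
  case Zero
  then have "\<sigma>(out := z) = \<sigma>" using eval_ZeroE[OF Zero.prems(1)] by (metis fun_upd_idem)
  then show ?case by (simp add: exec_Skip)
next
  case Succ
  then obtain x xs' where x: "xs = x # xs'" "z = Suc x" by (auto elim: eval_SuccE)
  with Succ.prems obtain a as where ins: "ins = a # as" "\<sigma> a = x" by auto
  have c: "exec (copy a out fr) \<sigma> (\<sigma>(out := \<sigma> out + \<sigma> a))"
    using Succ.prems ins by (intro exec_copy) auto
  have "exec (Seq (copy a out fr) (Inc out)) \<sigma> (\<sigma>(out := z))"
    using exec_Seq[OF c exec_Inc[of out]] x ins Succ.prems by simp
  then show ?case by (simp add: ins(1) del: fun_upd_apply)
next
  case (Proj i)
  then have i: "i < length xs" "z = xs ! i" by (auto elim: eval_ProjE)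
  with Proj.prems have "i < length ins" "ins ! i \<in> set ins" "ins ! i < fr"
    by (auto simp: subset_iff)
  moreover have "exec (copy (ins ! i) out fr) \<sigma> (\<sigma>(out := \<sigma> out + \<sigma> (ins ! i)))"
    using Proj.prems calculation by (intro exec_copy) auto
  moreover have "z = \<sigma> (ins ! i)" using i Proj.prems(2) by auto
  ultimately show ?case using Proj.prems(7) by (simp del: fun_upd_apply)
next
  case (Comp f gs)
  from Comp.prems(1) obtain ys where ys: "length ys = length gs"
    "\<And>i. i < length gs \<Longrightarrow> eval_recf (gs ! i) xs (ys ! i)" "eval_recf f ys z"
    by (auto elim: eval_CompE)
  let ?n = "length gs"
  \<comment> \<open>Store after the first \<open>j\<close> argument functions have been evaluated
    into the registers from \<open>fr\<close> on.\<close>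
  let ?S = "\<lambda>j r. if fr \<le> r \<and> r < fr + j then ys ! (r - fr) else \<sigma> r"
  let ?cs = "map (\<lambda>(j, g). comp_recf g ins (fr + j) (fr + ?n)) (zip [0..<?n] gs)"
  have 1: "exec (seqs ?cs) (?S 0) (?S (length ?cs))"
  proof (rule exec_seqs_chain[where S = ?S])
    fix j assume "j < length ?cs"
    then have j: "j < ?n" by simp
    have upd: "?S (Suc j) = (?S j)(fr + j := ys ! j)"
      by (auto simp: fun_eq_iff less_Suc_eq)
    have "exec (comp_recf (gs ! j) ins (fr + j) (fr + ?n)) (?S j) ((?S j)(fr + j := ys ! j))"
    proof (rule Comp.IH(2)[OF _ ys(2)[OF j]])
      show "map (?S j) ins = xs" using Comp.prems(2,3) by force
      show "set ins \<subseteq> {..<fr + ?n}" using Comp.prems(3) by force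
      show "fr + j \<notin> set ins" using Comp.prems(3) by force
    qed (use j Comp.prems in auto)
    with j upd show "exec (?cs ! j) (?S j) (?S (Suc j))" by simp
  qed
  have S0: "?S 0 = \<sigma>" by (auto simp: fun_eq_iff)
  let ?s = "?S ?n"
  have 2: "exec (comp_recf f [fr..<fr + ?n] out (fr + ?n)) ?s (?s(out := z))"
  proof (rule Comp.IH(1)[OF ys(3)])
    show "map ?s [fr..<fr + ?n] = ys" using ys(1) by (intro nth_equalityI) auto
  qed (use Comp.prems in auto)
  let ?T = "\<lambda>j r. if fr \<le> r \<and> r < fr + j then 0 else (?s(out := z)) r"
  let ?ds = "map (\<lambda>j. Loop (fr + j) Skip) [0..<?n]"
  have 3: "exec (seqs ?ds) (?T 0) (?T (length ?ds))"
  proof (rule exec_seqs_chain[where S = ?T])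
    fix j assume "j < length ?ds"
    then have j: "j < ?n" by simp
    have "?T (Suc j) = (?T j)(fr + j := 0)" by (auto simp: fun_eq_iff less_Suc_eq)
    then show "exec (?ds ! j) (?T j) (?T (Suc j))" using j exec_clear[of "fr + j" "?T j"] by simp
  qed
  have T0: "?T 0 = ?s(out := z)" by (auto simp: fun_eq_iff)
  have Tn: "?T (length ?ds) = \<sigma>(out := z)" using Comp.prems by (auto simp: fun_eq_iff)
  have len: "?S (length ?cs) = ?s" by simp
  show ?case
    using exec_Seq[OF 1[unfolded S0 len] exec_Seq[OF 2 3[unfolded T0 Tn]]] by (simp del: fun_upd_apply)
next
  case (PrimRec f g)
  obtain k xs' where xs: "xs = k # xs'"
    using eval_PrimRec_nonempty[OF PrimRec.prems(1)] by (cases xs) auto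
  obtain a as where ins: "ins = a # as" "\<sigma> a = k" "map \<sigma> as = xs'"
    using PrimRec.prems(2) xs by auto
  obtain r where r: "eval_recf f xs' (r 0)" "\<And>j. j < k \<Longrightarrow> eval_recf g (j # r j # xs') (r (Suc j))" "r k = z"
    using eval_PrimRec_chain PrimRec.prems(1) xs by blast
  have lt: "a < fr" "\<And>x. x \<in> set as \<Longrightarrow> x < fr" "a \<noteq> out" "out \<notin> set as" "out < fr"
    using PrimRec.prems ins by auto
  have z: "\<And>r. r \<ge> fr \<Longrightarrow> \<sigma> r = 0" "\<sigma> out = 0" using PrimRec.prems by auto
  have 1: "exec (copy a fr (fr + 3)) \<sigma> (\<sigma>(fr := k))"
    using exec_copy[of a fr "fr + 3" \<sigma>] lt z ins by simp
  have 2: "exec (comp_recf f as out (fr + 3)) (\<sigma>(fr := k)) (\<sigma>(fr := k, out := r 0))"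
  proof (rule PrimRec.IH(1)[OF r(1)])
    show "map (\<sigma>(fr := k)) as = xs'" using ins lt by force
    show "set as \<subseteq> {..<fr + 3}" using lt(2) by force
  qed (use lt z in auto)
  let ?body = "Seq (comp_recf g ((fr + 1) # out # as) (fr + 2) (fr + 3))
                  (Seq (Loop out Skip) (Seq (Loop (fr + 2) (Inc out)) (Inc (fr + 1))))"
  \<comment> \<open>\<open>fr\<close> counts the remaining passes down while \<open>fr + 1\<close>
    counts the recursion argument up, since \<open>g\<close> is applied to the arguments in
    ascending order.\<close>
  let ?S = "\<lambda>j. \<sigma>(fr := k - j, fr + 1 := j, out := r j)"
  have 3: "exec (Loop fr ?body) (?S 0) (?S k)"
  proof (rule exec_Loop_chain[where S = ?S])
    fix j assume j: "j < k"
    let ?u = "(?S j)(fr := ?S j fr - 1)"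
    have a: "exec (comp_recf g ((fr + 1) # out # as) (fr + 2) (fr + 3)) ?u (?u(fr + 2 := r (Suc j)))"
    proof (rule PrimRec.IH(2)[OF r(2)[OF j]])
      have "map ?u as = map \<sigma> as" using lt by (auto dest: lt(2))
      then show "map ?u ((fr + 1) # out # as) = j # r j # xs'" using ins lt by simp
      show "set ((fr + 1) # out # as) \<subseteq> {..<fr + 3}" using lt(2,5) by force
      show "fr + 2 \<notin> set ((fr + 1) # out # as)" using lt(2)[of "fr + 2"] lt(5) by auto
    qed (use lt z in auto)
    let ?v = "?u(fr + 2 := r (Suc j))"
    have b: "exec (Loop out Skip) ?v (?v(out := 0))" by (rule exec_clear)
    let ?w = "?v(out := 0)"
    let ?x = "?w(fr + 2 := 0, out := ?w out + ?w (fr + 2))"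
    have c: "exec (Loop (fr + 2) (Inc out)) ?w ?x"
      by (rule exec_move) (use lt in auto)
    have d: "exec (Inc (fr + 1)) ?x (?x(fr + 1 := Suc (?x (fr + 1))))" by (rule exec_Inc)
    have "?x(fr + 1 := Suc (?x (fr + 1))) = ?S (Suc j)"
      using lt z j by (auto simp: fun_eq_iff)
    then show "0 < ?S j fr \<and> exec ?body ?u (?S (Suc j))"
      using exec_Seq[OF a exec_Seq[OF b exec_Seq[OF c d]]] j lt by auto
  qed (use lt in auto)
  have S0: "?S 0 = \<sigma>(fr := k, out := r 0)" using lt z by (auto simp: fun_eq_iff)
  have 4: "exec (Loop (fr + 1) Skip) (?S k) ((?S k)(fr + 1 := 0))" by (rule exec_clear)
  have S4: "(?S k)(fr + 1 := 0) = \<sigma>(out := z)" using lt z r(3) by (auto simp: fun_eq_iff)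
  show ?case
    using exec_Seq[OF 1 exec_Seq[OF 2 exec_Seq[OF 3[unfolded S0] 4[unfolded S4]]]] ins by (simp del: fun_upd_apply)
next
  case (Mn f)
  have e: "eval_recf f (z # xs) 0" "\<And>j. j < z \<Longrightarrow> \<exists>v. eval_recf f (j # xs) v \<and> v \<noteq> 0"
    using Mn.prems(1) by (auto elim: eval_MnE)
  then obtain v where v: "\<And>j. j < z \<Longrightarrow> eval_recf f (j # xs) (v j) \<and> v j \<noteq> 0" by metis
  have lt: "\<And>x. x \<in> set ins \<Longrightarrow> x < fr" "out \<notin> set ins" "out < fr" using Mn.prems by auto
  have zz: "\<And>r. r \<ge> fr \<Longrightarrow> \<sigma> r = 0" "\<sigma> out = 0" using Mn.prems by auto
  \<comment> \<open>Register \<open>fr\<close> is the flag that keeps the search going; it is raised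
    again only if the candidate in \<open>out\<close> gives a nonzero value. The extra index
    \<open>Suc z\<close> is the store after the successful pass, with the flag down.\<close>
  let ?S = "\<lambda>j. if j = Suc z then \<sigma>(out := z) else \<sigma>(fr := 1, out := j)"
  let ?inner = "Seq (Loop (fr + 1) Skip) (Seq (Inc out) (Inc fr))"
  let ?body = "Seq (comp_recf f (out # ins) (fr + 1) (fr + 2)) (Loop (fr + 1) ?inner)"
  have run: "exec (comp_recf f (out # ins) (fr + 1) (fr + 2)) (\<sigma>(out := j)) (\<sigma>(out := j, fr + 1 := y))"
    if "eval_recf f (j # xs) y" for j y
  proof (rule Mn.IH[OF that])
    show "map (\<sigma>(out := j)) (out # ins) = j # xs" using Mn.prems(2) lt by auto
    show "set (out # ins) \<subseteq> {..<fr + 2}" using lt(1,3) by force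
    show "fr + 1 \<notin> set (out # ins)" using lt(1)[of "fr + 1"] lt(3) by auto
  qed (use lt zz in auto)
  have 1: "exec (Loop fr ?body) (?S 0) (?S (Suc z))"
  proof (rule exec_Loop_chain[where S = ?S])
    fix j assume j: "j < Suc z"
    have u: "(?S j)(fr := ?S j fr - 1) = \<sigma>(out := j)" using j lt zz by (auto simp: fun_eq_iff)
    show "0 < ?S j fr \<and> exec ?body ((?S j)(fr := ?S j fr - 1)) (?S (Suc j))"
    proof (cases "j = z")
      case True
      have idem: "\<sigma>(out := z, fr + 1 := 0) = \<sigma>(out := z)" using lt zz by (auto simp: fun_eq_iff)
      have "(\<sigma>(out := z)) (fr + 1) = 0" using lt zz by simp
      then have "exec (Loop (fr + 1) ?inner) (\<sigma>(out := z)) (\<sigma>(out := z))" by (rule exec_Loop0)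
      with run[OF e(1)] have "exec ?body (\<sigma>(out := z)) (\<sigma>(out := z))"
        unfolding idem by (rule exec_Seq)
      then show ?thesis unfolding u using True lt by simp
    next
      case False
      then have jz: "j < z" using j by simp
      let ?a = "\<sigma>(out := j, fr + 1 := v j)"
      let ?b = "?a(fr + 1 := v j - 1)"
      have "exec ?inner ?b (((?b(fr + 1 := 0))(out := Suc j))(fr := 1))"
        using exec_Seq[OF exec_clear[of "fr + 1" ?b] exec_Seq[OF exec_Inc[of out] exec_Inc[of fr]]] lt zz
        by auto
      moreover have "((?b(fr + 1 := 0))(out := Suc j))(fr := 1) = ?S (Suc j)"
        using lt zz jz by (auto simp: fun_eq_iff)
      ultimately have i: "exec ?inner ?b (?S (Suc j))" by simp
      have "?S (Suc j) (fr + 1) = 0" using lt zz by auto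
      then have "exec (Loop (fr + 1) ?inner) (?S (Suc j)) (?S (Suc j))" by (rule exec_Loop0)
      then have "exec (Loop (fr + 1) ?inner) ?a (?S (Suc j))"
        using v[OF jz] by (intro exec_LoopS[OF _ i]) auto
      then have "exec ?body (\<sigma>(out := j)) (?S (Suc j))"
        using exec_Seq run v[OF jz] by blast
      then show ?thesis unfolding u using jz lt by simp
    qed
  qed (use lt zz in auto)
  have "exec (Inc fr) \<sigma> (?S 0)" using exec_Inc[of fr \<sigma>] lt zz by (simp add: fun_upd_idem)
  from exec_Seq[OF this 1] show ?case by (simp del: fun_upd_apply)
qed

section \<open>Generalized Collatz machines\<close>

text \<open>Row \<open>k\<close> is the instruction of state \<open>k\<close>. Its entry
  \<open>(a, b, t)\<close> at index \<open>r\<close> serves the numbers congruent to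
  \<open>r\<close> modulo the row length. With a single number as memory, registers can be held as
  prime exponents.\<close>

type_synonym collatz_prog = "(nat \<times> nat \<times> nat) list list"

definition collatz_step :: "collatz_prog \<Rightarrow> nat \<times> nat \<Rightarrow> nat \<times> nat \<Rightarrow> bool" where
  "collatz_step P = (\<lambda>(k, N) c'. k < length P \<and> P ! k \<noteq> [] \<and>
     (case P ! k ! (N mod length (P ! k)) of (a, b, t) \<Rightarrow> c' = (t, a * (N div length (P ! k)) + b)))"

section \<open>Registers as prime exponents of one number\<close>

definition reg_prime :: "nat \<Rightarrow> nat" where
  "reg_prime = Infinite_Set.enumerate {p::nat. prime p}"

lemma prime_reg_prime: "prime (reg_prime r)"
  using enumerate_in_set[OF primes_infinite] unfolding reg_prime_def by blast

lemma reg_prime_gt_1: "reg_prime r > 1"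
  using prime_reg_prime prime_gt_1_nat by blast

lemma reg_prime_inj: "reg_prime r = reg_prime s \<longleftrightarrow> r = s"
  unfolding reg_prime_def using strict_mono_enumerate[OF primes_infinite]
  by (simp add: strict_mono_eq)

lemma reg_prime_0: "reg_prime 0 = 2"
  unfolding reg_prime_def enumerate_0
  by (rule Least_equality) (use two_is_prime_nat prime_ge_2_nat in auto)

text \<open>Goedel numbering: incrementing a register is multiplication by its prime, and testing it
  for zero is a divisibility test.\<close>

definition enc :: "nat \<Rightarrow> (nat \<Rightarrow> nat) \<Rightarrow> nat" where
  "enc R \<sigma> = (\<Prod>k<R. reg_prime k ^ \<sigma> k)"

lemma enc_inc:
  assumes "r < R"
  shows "enc R (\<sigma>(r := Suc (\<sigma> r))) = reg_prime r * enc R \<sigma>"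
proof -
  have *: "enc R \<tau> = reg_prime r ^ \<tau> r * (\<Prod>k\<in>{..<R} - {r}. reg_prime k ^ \<tau> k)" for \<tau>
    unfolding enc_def using assms by (intro prod.remove) auto
  have "(\<Prod>k\<in>{..<R} - {r}. reg_prime k ^ (\<sigma>(r := Suc (\<sigma> r))) k) = (\<Prod>k\<in>{..<R} - {r}. reg_prime k ^ \<sigma> k)"
    by (rule prod.cong) auto
  then show ?thesis unfolding *[of "\<sigma>(r := Suc (\<sigma> r))"] *[of \<sigma>] by simp
qed

lemma reg_prime_dvd_enc:
  assumes "r < R"
  shows "reg_prime r dvd enc R \<sigma> \<longleftrightarrow> \<sigma> r > 0"
proof
  assume "reg_prime r dvd enc R \<sigma>"
  then have "\<exists>k\<in>{..<R}. reg_prime r dvd reg_prime k ^ \<sigma> k"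
    unfolding enc_def by (subst (asm) prime_dvd_prod_iff[OF finite_lessThan prime_reg_prime])
  then obtain k where k: "reg_prime r dvd reg_prime k ^ \<sigma> k" by (elim bexE)
  have "reg_prime r dvd reg_prime k" by (rule prime_dvd_power[OF prime_reg_prime k])
  then have "reg_prime r = reg_prime k" by (rule primes_dvd_imp_eq[OF prime_reg_prime prime_reg_prime])
  then have kr: "k = r" by (simp only: reg_prime_inj)
  show "\<sigma> r > 0"
  proof (rule ccontr)
    assume "\<not> \<sigma> r > 0"
    then have "reg_prime r dvd 1" using k unfolding kr by simp
    then show False using reg_prime_gt_1[of r] by simp
  qed
next
  assume "\<sigma> r > 0"
  then have "reg_prime r dvd reg_prime r ^ \<sigma> r" by (intro dvd_power) simp
  also have "\<dots> dvd enc R \<sigma>"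
    unfolding enc_def using assms by (intro dvd_prodI) simp_all
  finally show "reg_prime r dvd enc R \<sigma>" .
qed

section \<open>Compilation of loop programs into Collatz machines\<close>

fun regs :: "cmd \<Rightarrow> nat set" where
  "regs Skip = {}"
| "regs (Inc r) = {r}"
| "regs (Seq c d) = regs c \<union> regs d"
| "regs (Loop r c) = insert r (regs c)"

lemma finite_regs: "finite (regs c)"
  by (induction c) auto

text \<open>A row of length one is an unconditional instruction. In the loop row, residue 0 means
  that the register is positive: dividing by the prime decrements it and enters the body. The other
  residues restore the number and jump past the row that closes the loop.\<close>

fun comp_cmd :: "nat \<Rightarrow> cmd \<Rightarrow> collatz_prog" where
  "comp_cmd i Skip = []"
| "comp_cmd i (Inc r) = [[(reg_prime r, 0, Suc i)]]"
| "comp_cmd i (Seq c d) = (let C = comp_cmd i c in C @ comp_cmd (i + length C) d)"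
| "comp_cmd i (Loop r c) = (let C = comp_cmd (Suc i) c in
     ((1, 0, Suc i) # map (\<lambda>q. (reg_prime r, q, i + length C + 2)) [1..<reg_prime r]) # C @ [[(1, 0, i)]])"

definition code_at :: "collatz_prog \<Rightarrow> nat \<Rightarrow> collatz_prog \<Rightarrow> bool" where
  "code_at P i C \<longleftrightarrow> (\<exists>A B. P = A @ C @ B \<and> length A = i)"

lemma code_at_append: "code_at P i (C @ D) \<longleftrightarrow> code_at P i C \<and> code_at P (i + length C) D"
proof
  assume "code_at P i (C @ D)"
  then obtain A B where "P = A @ C @ D @ B" "length A = i" unfolding code_at_def by auto
  then show "code_at P i C \<and> code_at P (i + length C) D"
    unfolding code_at_def by (metis append.assoc length_append)
next
  assume *: "code_at P i C \<and> code_at P (i + length C) D"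
  then obtain A B A' B' where "P = A @ C @ B" "length A = i" "P = A' @ D @ B'" "length A' = i + length C"
    unfolding code_at_def by blast
  then have "A' = A @ C" by (metis append.assoc append_eq_append_conv length_append)
  then show "code_at P i (C @ D)" unfolding code_at_def
    using \<open>P = A' @ D @ B'\<close> \<open>length A = i\<close> by auto
qed

lemma code_at_Cons: "code_at P i (x # C) \<longleftrightarrow> i < length P \<and> P ! i = x \<and> code_at P (Suc i) C"
proof -
  have "code_at P i [x] \<longleftrightarrow> i < length P \<and> P ! i = x"
  proof
    assume "i < length P \<and> P ! i = x"
    then have "P = take i P @ [x] @ drop (Suc i) P" "length (take i P) = i"
      using id_take_nth_drop[of i P] by auto
    then show "code_at P i [x]" unfolding code_at_def by blast
  qed (auto simp: code_at_def nth_append)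
  then show ?thesis using code_at_append[of P i "[x]" C] by simp
qed

lemma collatz_exec:
  assumes "exec c \<sigma> \<sigma>'" "code_at P i (comp_cmd i c)" "regs c \<subseteq> {..<R}"
  shows "(collatz_step P)\<^sup>*\<^sup>* (i, enc R \<sigma>) (i + length (comp_cmd i c), enc R \<sigma>')"
  using assms
proof (induction arbitrary: i rule: exec.induct)
  case (exec_Skip \<sigma>)
  then show ?case by simp
next
  case (exec_Inc r \<sigma>)
  then have "collatz_step P (i, enc R \<sigma>) (Suc i, enc R (\<sigma>(r := Suc (\<sigma> r))))"
    by (simp add: code_at_Cons collatz_step_def enc_inc del: fun_upd_apply)
  then show ?case by (auto simp del: fun_upd_apply)
next
  case (exec_Seq c \<sigma> \<sigma>' d \<sigma>'')
  then show ?case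
    using rtranclp_trans[OF exec_Seq.IH(1)[of i] exec_Seq.IH(2)[of "i + length (comp_cmd i c)"]]
    by (simp add: Let_def code_at_append add.assoc)
next
  case (exec_Loop0 \<sigma> r c)
  let ?p = "reg_prime r"
  let ?q = "enc R \<sigma> mod ?p"
  have "?q \<noteq> 0" using reg_prime_dvd_enc[of r R \<sigma>] exec_Loop0 by (auto simp: dvd_eq_mod_eq_0)
  moreover have "?q < ?p" using reg_prime_gt_1[of r] by simp
  \<comment> \<open>The head entry occupies index 0, so the list over \<open>[1..<p]\<close> places
    the entry for residue \<open>q\<close> at index \<open>q\<close>.\<close>
  moreover have "(x # map (\<lambda>q. (p, q, t)) [1..<p]) ! q = (p, q, t)" if "q \<noteq> 0" "q < p"
    for p q t :: nat and x
    using that by (cases q) auto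
  ultimately have row: "((1, 0, Suc i) # map (\<lambda>q. (?p, q, t)) [1..<?p]) ! ?q = (?p, ?q, t)" for t
    by blast
  have "P ! i = (1, 0, Suc i) # map (\<lambda>q. (?p, q, i + length (comp_cmd (Suc i) c) + 2)) [1..<?p]"
    "i < length P"
    using exec_Loop0.prems(1) unfolding comp_cmd.simps Let_def code_at_append code_at_Cons append_Cons
    by blast+
  moreover have "length (P ! i) = ?p" using calculation reg_prime_gt_1[of r] by simp
  ultimately have "collatz_step P (i, enc R \<sigma>)
      (i + length (comp_cmd (Suc i) c) + 2, ?p * (enc R \<sigma> div ?p) + ?q)"
    unfolding collatz_step_def using row by simp
  then have "collatz_step P (i, enc R \<sigma>) (i + length (comp_cmd i (Loop r c)), enc R \<sigma>)"
    by (simp add: Let_def)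
  then show ?case by auto
next
  case (exec_LoopS \<sigma> r k c \<sigma>' \<sigma>'')
  let ?p = "reg_prime r" and ?C = "comp_cmd (Suc i) c"
  have r: "r < R" using exec_LoopS.prems by auto
  have e: "enc R \<sigma> = ?p * enc R (\<sigma>(r := k))"
    using enc_inc[OF r, of "\<sigma>(r := k)"] exec_LoopS.hyps by (simp add: fun_upd_idem)
  then have "collatz_step P (i, enc R \<sigma>) (Suc i, enc R (\<sigma>(r := k)))"
    using exec_LoopS.prems reg_prime_gt_1[of r]
    by (auto simp: Let_def code_at_Cons collatz_step_def)
  moreover have "(collatz_step P)\<^sup>*\<^sup>* (Suc i, enc R (\<sigma>(r := k))) (Suc i + length ?C, enc R \<sigma>')"
    using exec_LoopS.prems by (intro exec_LoopS.IH(1)) (auto simp: Let_def code_at_Cons code_at_append)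
  moreover have "collatz_step P (Suc i + length ?C, enc R \<sigma>') (i, enc R \<sigma>')"
    using exec_LoopS.prems by (auto simp: Let_def code_at_Cons code_at_append collatz_step_def)
  moreover have "(collatz_step P)\<^sup>*\<^sup>* (i, enc R \<sigma>') (i + length (comp_cmd i (Loop r c)), enc R \<sigma>'')"
    using exec_LoopS.prems by (intro exec_LoopS.IH(2))
  ultimately show ?case by (meson converse_rtranclp_into_rtranclp rtranclp_trans)
qed

text \<open>The machine halts in both cases, with different numbers. Thus a negative answer is
  witnessed by a halting run as well, and determinism will exclude the positive one.\<close>

theorem collatz_simulation:
  assumes "\<And>x. eval_recf f [x] (if x \<in> A then 1 else 0)"
  shows "\<exists>P. P \<noteq> [] \<and>
    (\<forall>x. (collatz_step P)\<^sup>*\<^sup>* (0, 2 ^ x) (length P, if x \<in> A then reg_prime 1 else 1))"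
proof -
  \<comment> \<open>Register 0 holds the input and register 1 the answer. Clearing the input makes
    the halting number depend on the answer alone.\<close>
  define c where "c = Seq (comp_recf f [0] 1 2) (Loop 0 Skip)"
  let ?P = "comp_cmd 0 c"
  obtain R0 where R0: "regs c \<subseteq> {..<R0}" using finite_nat_iff_bounded finite_regs by blast
  define R where "R = R0 + 2"
  have R: "regs c \<subseteq> {..<R}" "R \<ge> 2" using R0 by (auto simp: R_def)
  have enc0: "enc R (\<lambda>r. if r = k then n else 0) = reg_prime k ^ n" if "k < R" for k n
  proof -
    have "enc R (\<lambda>r. if r = k then n else 0) = (\<Prod>r<R. if r = k then reg_prime k ^ n else 1)"
      unfolding enc_def by (rule prod.cong) auto
    then show ?thesis using that by simp
  qed
  have "(collatz_step ?P)\<^sup>*\<^sup>* (0, 2 ^ x) (length ?P, if x \<in> A then reg_prime 1 else 1)" for x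
  proof -
    let ?z = "if x \<in> A then 1 else 0 :: nat"
    let ?s = "\<lambda>r::nat. if r = 0 then x else 0 :: nat"
    have "exec (comp_recf f [0] 1 2) ?s (?s(1 := ?z))"
      by (rule exec_comp_recf[OF assms]) auto
    from exec_Seq[OF this exec_clear[of 0], folded c_def] have "exec c ?s ((?s(1 := ?z))(0 := 0))" .
    moreover have "(?s(1 := ?z))(0 := 0) = (\<lambda>r::nat. if r = 1 then ?z else 0)" by (auto simp: fun_eq_iff)
    ultimately have ex: "exec c ?s (\<lambda>r. if r = 1 then ?z else 0)" by (simp only:)
    have "code_at ?P 0 ?P" unfolding code_at_def by (rule exI[of _ "[]"]) simp
    from collatz_exec[OF ex this R(1)]
    have "(collatz_step ?P)\<^sup>*\<^sup>* (0, enc R ?s) (length ?P, enc R (\<lambda>r. if r = 1 then ?z else 0))"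
      by simp
    moreover have "enc R ?s = 2 ^ x" using enc0[of 0 x] R(2) by (simp add: reg_prime_0)
    moreover have "enc R (\<lambda>r. if r = 1 then ?z else 0) = (if x \<in> A then reg_prime 1 else 1)"
      using enc0[of 1 ?z] R(2) by simp
    ultimately show ?thesis by (simp only:)
  qed
  moreover have "?P \<noteq> []" by (simp add: Let_def c_def)
  ultimately show ?thesis by (intro exI[of _ ?P]) auto
qed

section \<open>Derivations on differential polynomials\<close>

text \<open>Both \<open>deriv_l\<close> and the functional \<open>fnl\<close> are instances.\<close>
definition lin_ext :: "('t \<Rightarrow> 'a::comm_ring_1 \<Rightarrow> 'b::ab_group_add) \<Rightarrow> ('t \<Rightarrow>\<^sub>0 'a) \<Rightarrow> 'b" where
  "lin_ext F p = (\<Sum>t\<in>Poly_Mapping.keys p. F t (Poly_Mapping.lookup p t))"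

lemma lin_ext_superset:
  assumes "\<And>t. F t 0 = 0" "finite A" "Poly_Mapping.keys p \<subseteq> A"
  shows "lin_ext F p = (\<Sum>t\<in>A. F t (Poly_Mapping.lookup p t))"
  unfolding lin_ext_def using assms by (intro sum.mono_neutral_left) (auto simp: in_keys_iff)

lemma lin_ext_add:
  assumes "\<And>t a b. F t (a + b) = F t a + F t b"
  shows "lin_ext F (p + q) = lin_ext F p + lin_ext F q"
proof -
  have z: "F t 0 = 0" for t using assms[of t 0 0] by simp
  let ?A = "Poly_Mapping.keys p \<union> Poly_Mapping.keys q"
  have "lin_ext F r = (\<Sum>t\<in>?A. F t (Poly_Mapping.lookup r t))" if "Poly_Mapping.keys r \<subseteq> ?A" for r
    using that by (intro lin_ext_superset z) auto
  from this[of p] this[of q] this[of "p + q"] show ?thesis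
    using keys_add[of p q] by (simp add: lookup_add assms sum.distrib)
qed

lemma lin_ext_single:
  assumes "\<And>t. F t 0 = 0"
  shows "lin_ext F (Poly_Mapping.single t c) = F t c"
  using lin_ext_superset[of F "{t}" "Poly_Mapping.single t c"] assms by simp

lemma poly_mapping_single_induct [case_names zero single]:
  assumes "P 0" "\<And>p t c. P p \<Longrightarrow> P (Poly_Mapping.single t c + p)"
  shows "P (p :: 't \<Rightarrow>\<^sub>0 'a::comm_monoid_add)"
proof (induction p rule: update_induct)
  case (update p k v)
  then have "Poly_Mapping.update k v p = Poly_Mapping.single k v + p"
    by (intro poly_mapping_eqI) (auto simp: lookup_update lookup_add lookup_single in_keys_iff)
  with update assms(2) show ?case by metis
qed (rule assms(1))

definition deriv_mono :: "nat \<Rightarrow> (dvar \<Rightarrow>\<^sub>0 nat) \<Rightarrow> 'a::comm_ring_1 \<Rightarrow> 'a dpoly" where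
  "deriv_mono l t c = (\<Sum>v\<in>Poly_Mapping.keys t.
      Poly_Mapping.single (t - Poly_Mapping.single v 1 + Poly_Mapping.single (shift_var l v) 1)
        (c * of_nat (Poly_Mapping.lookup t v)))"

lemma deriv_l_lin_ext: "deriv_l l = lin_ext (deriv_mono l)"
  by (simp add: fun_eq_iff deriv_l_def lin_ext_def deriv_mono_def)

lemma deriv_mono_add: "deriv_mono l t (a + b) = deriv_mono l t a + deriv_mono l t b"
  by (simp add: deriv_mono_def distrib_right single_add sum.distrib)

lemma deriv_l_add: "deriv_l l (p + q) = deriv_l l p + deriv_l l q"
  unfolding deriv_l_lin_ext by (rule lin_ext_add) (rule deriv_mono_add)

lemma deriv_l_single: "deriv_l l (Poly_Mapping.single t c) = deriv_mono l t c"
  unfolding deriv_l_lin_ext by (rule lin_ext_single) (simp add: deriv_mono_def)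

lemma deriv_l_0 [simp]: "deriv_l l 0 = 0"
  by (simp add: deriv_l_def)

lemma deriv_l_minus: "deriv_l l (- p) = - deriv_l l p"
  using deriv_l_add[of l p "- p"] by (simp add: eq_neg_iff_add_eq_0 add.commute)

lemma deriv_l_diff: "deriv_l l (p - q) = deriv_l l p - deriv_l l q"
  using deriv_l_add[of l p "- q"] by (simp add: deriv_l_minus)

lemma deriv_mono_superset:
  assumes "finite A" "Poly_Mapping.keys t \<subseteq> A"
  shows "deriv_mono l t c = (\<Sum>v\<in>A.
      Poly_Mapping.single (t - Poly_Mapping.single v 1 + Poly_Mapping.single (shift_var l v) 1)
        (c * of_nat (Poly_Mapping.lookup t v)))"
  unfolding deriv_mono_def using assms by (intro sum.mono_neutral_left) (auto simp: in_keys_iff)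

lemma deriv_mono_mult:
  "deriv_mono l (t + u) (c * d) =
     deriv_mono l t c * Poly_Mapping.single u d + Poly_Mapping.single t c * deriv_mono l u d"
proof -
  let ?A = "Poly_Mapping.keys t \<union> Poly_Mapping.keys u"
  let ?s = "\<lambda>v. Poly_Mapping.single v (1::nat)"
  let ?h = "\<lambda>v. ?s (shift_var l v)"
  \<comment> \<open>Subtraction of exponents is truncated, so a factor can be split off only if
    \<open>v\<close> occurs in \<open>w\<close>. Where it does not, the coefficient of the summand
    is zero.\<close>
  have move: "w + w' - ?s v + ?h v = (w - ?s v + ?h v) + w'" if "Poly_Mapping.lookup w v \<noteq> 0"
    for w w' :: "dvar \<Rightarrow>\<^sub>0 nat" and v
  proof (rule poly_mapping_eqI)
    fix x show "Poly_Mapping.lookup (w + w' - ?s v + ?h v) x =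
        Poly_Mapping.lookup (w - ?s v + ?h v + w') x"
      using that by (cases "x = v") (auto simp: lookup_add lookup_minus lookup_single)
  qed
  have 1: "Poly_Mapping.single (t + u - ?s v + ?h v) (c * d * of_nat (Poly_Mapping.lookup t v)) =
      Poly_Mapping.single (t - ?s v + ?h v) (c * of_nat (Poly_Mapping.lookup t v)) * Poly_Mapping.single u d"
    for v
  proof (cases "Poly_Mapping.lookup t v = 0")
    case False
    show ?thesis unfolding mult_single move[OF False] by (simp only: mult_ac)
  qed simp
  have 2: "Poly_Mapping.single (t + u - ?s v + ?h v) (c * d * of_nat (Poly_Mapping.lookup u v)) =
      Poly_Mapping.single t c * Poly_Mapping.single (u - ?s v + ?h v) (d * of_nat (Poly_Mapping.lookup u v))"
    for v
  proof (cases "Poly_Mapping.lookup u v = 0")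
    case False
    show ?thesis unfolding mult_single using move[OF False, of t] by (simp only: ac_simps)
  qed simp
  have sub: "Poly_Mapping.keys (t + u) \<subseteq> ?A" by (rule keys_add)
  have "deriv_mono l (t + u) (c * d) =
      (\<Sum>v\<in>?A. Poly_Mapping.single (t + u - ?s v + ?h v) (c * d * of_nat (Poly_Mapping.lookup t v)))
    + (\<Sum>v\<in>?A. Poly_Mapping.single (t + u - ?s v + ?h v) (c * d * of_nat (Poly_Mapping.lookup u v)))"
    by (subst deriv_mono_superset[OF _ sub])
      (simp_all add: lookup_add distrib_left single_add sum.distrib)
  also have "\<dots> = deriv_mono l t c * Poly_Mapping.single u d + Poly_Mapping.single t c * deriv_mono l u d"
    unfolding 1 2
    by (simp add: deriv_mono_superset[of ?A t] deriv_mono_superset[of ?A u] sum_distrib_left sum_distrib_right)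
  finally show ?thesis .
qed

lemma deriv_l_mult: "deriv_l l (p * q) = deriv_l l p * q + p * deriv_l l q"
proof (induction p rule: poly_mapping_single_induct)
  case (single p t c)
  have "deriv_l l (Poly_Mapping.single t c * q) =
      deriv_l l (Poly_Mapping.single t c) * q + Poly_Mapping.single t c * deriv_l l q"
  proof (induction q rule: poly_mapping_single_induct)
    case (single q u d)
    then show ?case
      by (simp add: distrib_left deriv_l_add mult_single deriv_l_single deriv_mono_mult algebra_simps)
  qed simp
  with single show ?case by (simp add: distrib_right deriv_l_add algebra_simps)
qed simp

section \<open>Variables and closure properties of the differential polynomial ring\<close>

definition dv :: "dvar \<Rightarrow> 'a::comm_ring_1 dpoly" where
  "dv v = Poly_Mapping.single (Poly_Mapping.single v 1) 1"

lemma deriv_l_dv: "deriv_l l (dv v) = dv (shift_var l v)"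
  by (simp add: dv_def deriv_l_single deriv_mono_def)

lemma dpolys_add: "p \<in> dpolys n m \<Longrightarrow> q \<in> dpolys n m \<Longrightarrow> p + q \<in> dpolys n m"
  unfolding dpolys_def using keys_add[of p q] by blast

lemma dpolys_0: "0 \<in> dpolys n m"
  by (simp add: dpolys_def)

lemma dpolys_mult:
  assumes "p \<in> dpolys n m" "q \<in> dpolys n m"
  shows "p * q \<in> dpolys n m"
  unfolding dpolys_def mem_Collect_eq
proof (intro ballI)
  fix t v assume "t \<in> Poly_Mapping.keys (p * q)" "v \<in> Poly_Mapping.keys t"
  then obtain a b where "a \<in> Poly_Mapping.keys p" "b \<in> Poly_Mapping.keys q" "t = a + b"
    using keys_mult[of p q] by blast
  moreover from this have "v \<in> Poly_Mapping.keys a \<or> v \<in> Poly_Mapping.keys b"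
    using \<open>v \<in> Poly_Mapping.keys t\<close> keys_add[of a b] by blast
  ultimately show "fst v < n \<and> Poly_Mapping.keys (snd v) \<subseteq> {..<m}"
    using assms unfolding dpolys_def by blast
qed

lemma dpolys_uminus: "p \<in> dpolys n m \<Longrightarrow> - p \<in> dpolys n m"
  by (auto simp: dpolys_def in_keys_iff)

lemma dpolys_diff: "p \<in> dpolys n m \<Longrightarrow> q \<in> dpolys n m \<Longrightarrow> p - q \<in> dpolys n m"
  using dpolys_add[of p n m "- q"] dpolys_uminus[of q n m] by simp

lemma dpolys_1: "1 \<in> dpolys n m"
  by (auto simp: dpolys_def)

lemma dpolys_dv:
  "fst v < n \<Longrightarrow> Poly_Mapping.keys (snd v) \<subseteq> {..<m} \<Longrightarrow> dv v \<in> dpolys n m"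
  by (auto simp: dpolys_def dv_def split: if_splits)

lemma dpolys_sum: "(\<And>i. i \<in> A \<Longrightarrow> f i \<in> dpolys n m) \<Longrightarrow> sum f A \<in> dpolys n m"
  by (induction A rule: infinite_finite_induct) (auto intro: dpolys_add dpolys_0)

lemma dpolys_deriv:
  assumes "p \<in> dpolys n m" "l < m"
  shows "deriv_l l p \<in> dpolys n m"
proof -
  have "Poly_Mapping.single (t - Poly_Mapping.single v 1 + Poly_Mapping.single (shift_var l v) 1) c
      \<in> dpolys n m" if "t \<in> Poly_Mapping.keys p" "v \<in> Poly_Mapping.keys t" for t v and c :: 'a
  proof -
    have "fst w < n \<and> Poly_Mapping.keys (snd w) \<subseteq> {..<m}"
      if "w \<in> Poly_Mapping.keys (t - Poly_Mapping.single v 1 + Poly_Mapping.single (shift_var l v) 1)" for w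
    proof -
      have "w \<in> Poly_Mapping.keys t \<or> w = shift_var l v"
        using that by (auto simp: in_keys_iff lookup_add lookup_minus lookup_single split: if_splits)
      then show ?thesis
      proof
        assume "w = shift_var l v"
        moreover have "Poly_Mapping.keys (snd v + Poly_Mapping.single l 1) \<subseteq> Poly_Mapping.keys (snd v) \<union> {l}"
          using keys_add[of "snd v" "Poly_Mapping.single l 1"] by auto
        moreover have "fst v < n" "Poly_Mapping.keys (snd v) \<subseteq> {..<m}"
          using assms \<open>t \<in> _\<close> \<open>v \<in> _\<close> unfolding dpolys_def by blast+
        ultimately show ?thesis using assms(2) by (auto simp: shift_var_def)
      qed (use assms \<open>t \<in> _\<close> in \<open>auto simp: dpolys_def\<close>)
    qed
    then show ?thesis by (auto simp: dpolys_def split: if_splits)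
  qed
  then show ?thesis unfolding deriv_l_def by (auto intro!: dpolys_sum)
qed

section \<open>Two-counter machines as differential ideals\<close>

text \<open>A free counter may exceed its value in the source, and the excess is carried over to the
  target. For a counter that is not free the source value must be met exactly, as in a zero
  test.\<close>

datatype 's rule = Rule (free0: bool) (free1: bool) (src: "'s \<times> nat \<times> nat") (tgt: "'s \<times> nat \<times> nat")

fun shift_conf :: "nat \<Rightarrow> nat \<Rightarrow> 's \<times> nat \<times> nat \<Rightarrow> 's \<times> nat \<times> nat" where
  "shift_conf e f (s, i, j) = (s, i + e, j + f)"

definition rule_step :: "'s rule set \<Rightarrow> 's \<times> nat \<times> nat \<Rightarrow> 's \<times> nat \<times> nat \<Rightarrow> bool" where
  "rule_step Rs c c' \<longleftrightarrow> (\<exists>r\<in>Rs. \<exists>e f. (free0 r \<or> e = 0) \<and> (free1 r \<or> f = 0) \<and>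
     c = shift_conf e f (src r) \<and> c' = shift_conf e f (tgt r))"

text \<open>Indeterminates 0 to 3 are reserved for states. Of indeterminates 4 and 5 only the
  derivatives in one direction matter, which form two sequences; those of indeterminate 6 form the
  grid of counter values.\<close>

definition w0 :: "nat \<Rightarrow> dvar" where "w0 k = (4, Poly_Mapping.single 0 k)"
definition w1 :: "nat \<Rightarrow> dvar" where "w1 k = (5, Poly_Mapping.single 1 k)"
definition xv :: "nat \<Rightarrow> nat \<Rightarrow> dvar" where
  "xv i j = (6, Poly_Mapping.single 0 i + Poly_Mapping.single 1 j)"

lemma shift_w0: "shift_var 0 (w0 k) = w0 (Suc k)"
  by (simp add: shift_var_def w0_def flip: single_add)

lemma shift_w1: "shift_var (Suc 0) (w1 k) = w1 (Suc k)"
  by (simp add: shift_var_def w1_def flip: single_add)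

lemma shift_xv0: "shift_var 0 (xv i j) = xv (Suc i) j"
proof -
  have "Poly_Mapping.single 0 (Suc i) = Poly_Mapping.single 0 i + Poly_Mapping.single (0::nat) (1::nat)"
    by (simp flip: single_add)
  then show ?thesis by (simp add: shift_var_def xv_def ac_simps)
qed

lemma shift_xv1: "shift_var (Suc 0) (xv i j) = xv i (Suc j)"
proof -
  have "Poly_Mapping.single 1 (Suc j) = Poly_Mapping.single 1 j + Poly_Mapping.single (1::nat) (1::nat)"
    by (simp flip: single_add)
  then show ?thesis by (simp add: shift_var_def xv_def ac_simps)
qed

lemma w0_eq: "w0 k = w0 k' \<longleftrightarrow> k = k'"
  unfolding w0_def by (metis lookup_single_eq snd_conv)

lemma w1_eq: "w1 k = w1 k' \<longleftrightarrow> k = k'"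
  unfolding w1_def by (metis lookup_single_eq snd_conv)

lemma xv_eq: "xv i j = xv i' j' \<longleftrightarrow> i = i' \<and> j = j'"
proof
  assume "xv i j = xv i' j'"
  then have *: "Poly_Mapping.lookup (Poly_Mapping.single 0 i + Poly_Mapping.single 1 j) n =
      Poly_Mapping.lookup (Poly_Mapping.single 0 i' + Poly_Mapping.single 1 j') n" for n :: nat
    by (simp add: xv_def)
  show "i = i' \<and> j = j'" using *[of 0] *[of 1] by (simp add: lookup_add lookup_single)
qed simp

lemma fst_vars [simp]: "fst (w0 k) = 4" "fst (w1 k) = 5" "fst (xv i j) = 6"
  by (simp_all add: w0_def w1_def xv_def)

text \<open>\<open>fnl\<close> vanishes on every monomial containing a variable that is not good.\<close>
definition good :: "dvar \<Rightarrow> bool" where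
  "good v \<longleftrightarrow> Poly_Mapping.keys (snd v) \<subseteq>
     (if fst v = 4 then {0} else if fst v = 5 then {1} else if fst v = 6 then {0, 1} else {})"

text \<open>A derivation only enlarges the support of the exponent vector, so the ideal generated by
  the bad variables is stable under all derivations.\<close>

lemma shift_bad: "\<not> good v \<Longrightarrow> \<not> good (shift_var l v)"
proof -
  have "Poly_Mapping.keys (snd v) \<subseteq> Poly_Mapping.keys (snd v + Poly_Mapping.single l 1)"
    by (auto simp: in_keys_iff lookup_add)
  then show "\<not> good v \<Longrightarrow> \<not> good (shift_var l v)" unfolding good_def shift_var_def by auto
qed

lemma shift_bad_new:
  assumes "l \<notin> (if fst v = 4 then {0} else if fst v = 5 then {1} else if fst v = 6 then {0, 1} else {})"
  shows "\<not> good (shift_var l v)"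
proof -
  have "l \<in> Poly_Mapping.keys (snd v + Poly_Mapping.single l 1)"
    by (auto simp: in_keys_iff lookup_add)
  then show ?thesis using assms unfolding good_def shift_var_def by auto
qed

lemma good_w0: "good (w0 k)" and good_w1: "good (w1 k)"
  by (auto simp: good_def w0_def w1_def)

lemma good_xv: "good (xv i j)"
  using keys_add[of "Poly_Mapping.single 0 i" "Poly_Mapping.single (1::nat) j"]
  by (auto simp: good_def xv_def split: if_splits)

section \<open>Ordinary ideals that are stable under derivations\<close>

inductive_set ideal_span :: "'a::comm_ring_1 dpoly set \<Rightarrow> 'a dpoly set" for B where
  span_zero: "0 \<in> ideal_span B"
| span_step: "b \<in> B \<Longrightarrow> p \<in> ideal_span B \<Longrightarrow> r * b + p \<in> ideal_span B"

lemma span_add: "p \<in> ideal_span B \<Longrightarrow> q \<in> ideal_span B \<Longrightarrow> p + q \<in> ideal_span B"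
  by (induction rule: ideal_span.induct) (auto simp: add.assoc intro: span_step)

lemma span_mult: "p \<in> ideal_span B \<Longrightarrow> r * p \<in> ideal_span B"
proof (induction rule: ideal_span.induct)
  case (span_step b p s)
  then show ?case
    using ideal_span.span_step[of b B "r * p" "r * s"] by (simp add: distrib_left mult.assoc)
qed (simp add: span_zero)

lemma span_base: "b \<in> B \<Longrightarrow> b \<in> ideal_span B"
  using span_step[OF _ span_zero, of b B 1] by simp

lemma span_uminus: "p \<in> ideal_span B \<Longrightarrow> - p \<in> ideal_span B"
  using span_mult[of p B "- 1"] by simp

lemma span_diff: "p \<in> ideal_span B \<Longrightarrow> q \<in> ideal_span B \<Longrightarrow> p - q \<in> ideal_span B"
  using span_add[of p B "- q"] span_uminus[of q B] by simp

lemma span_mult_right: "p \<in> ideal_span B \<Longrightarrow> p * r \<in> ideal_span B"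
  by (subst mult.commute) (rule span_mult)

text \<open>By the Leibniz rule the derivative of \<open>r * b\<close> is a combination of
  \<open>b\<close> and its derivative, so stability need only be checked on generators.\<close>

lemma span_deriv:
  assumes "\<And>b. b \<in> B \<Longrightarrow> deriv_l l b \<in> ideal_span B" "p \<in> ideal_span B"
  shows "deriv_l l p \<in> ideal_span B"
  using assms(2)
proof (induction rule: ideal_span.induct)
  case (span_step b p r)
  have "deriv_l l r * b + r * deriv_l l b + deriv_l l p \<in> ideal_span B"
    using span_step.hyps(1) span_step.IH
    by (intro span_add) (auto intro: span_mult span_base assms(1))
  then show ?case by (simp add: deriv_l_add deriv_l_mult)
qed (simp add: span_zero)

lemma span_sum: "(\<And>i. i \<in> A \<Longrightarrow> f i \<in> ideal_span B) \<Longrightarrow> sum f A \<in> ideal_span B"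
  by (induction A rule: infinite_finite_induct) (auto intro: span_add span_zero)

text \<open>Every summand is a multiple of the derivative of a variable of \<open>t\<close>. Hence a
  monomial in constants, such as a state monomial, is itself constant modulo the ideal.\<close>

lemma deriv_mono_factor:
  "deriv_mono l t c = (\<Sum>v\<in>Poly_Mapping.keys t.
     Poly_Mapping.single (t - Poly_Mapping.single v 1) (c * of_nat (Poly_Mapping.lookup t v)) * dv (shift_var l v))"
  by (simp add: deriv_mono_def dv_def mult_single)

lemma diff_idealD:
  assumes "is_diff_ideal n m I"
  shows "p \<in> I \<Longrightarrow> q \<in> I \<Longrightarrow> p + q \<in> I" "p \<in> I \<Longrightarrow> q \<in> I \<Longrightarrow> p - q \<in> I"
    "p \<in> I \<Longrightarrow> r \<in> dpolys n m \<Longrightarrow> r * p \<in> I" "p \<in> I \<Longrightarrow> r \<in> dpolys n m \<Longrightarrow> p * r \<in> I"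
    "p \<in> I \<Longrightarrow> l < m \<Longrightarrow> deriv_l l p \<in> I" "p \<in> I \<Longrightarrow> p \<in> dpolys n m" "0 \<in> I"
proof -
  have neg: "- q \<in> I" if "q \<in> I" for q
    using that assms dpolys_uminus[OF dpolys_1, of n m] unfolding is_diff_ideal_def
    by (metis mult_minus1)
  show "p \<in> I \<Longrightarrow> q \<in> I \<Longrightarrow> p - q \<in> I"
    using neg[of q] assms unfolding is_diff_ideal_def by (metis add_uminus_conv_diff)
qed (use assms in \<open>auto simp: is_diff_ideal_def mult.commute\<close>)

lemma diff_ideal_sum:
  assumes "is_diff_ideal n m I"
  shows "(\<And>i. i \<in> A \<Longrightarrow> f i \<in> I) \<Longrightarrow> sum f A \<in> I"
  by (induction A rule: infinite_finite_induct) (auto intro: diff_idealD[OF assms])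

lemma deriv_product_difference:
  "deriv_l l (g * (A * x - B * y)) =
     deriv_l l g * (A * x - B * y) + g * (deriv_l l A * x - deriv_l l B * y)
     + g * (A * deriv_l l x - B * deriv_l l y)"
  by (simp add: deriv_l_mult deriv_l_diff algebra_simps)

text \<open>Since \<open>g\<close>, \<open>A\<close> and \<open>B\<close> are constant modulo
  \<open>I\<close>, differentiating the relation differentiates only \<open>x\<close> and
  \<open>y\<close>; the remaining Leibniz terms lie in \<open>I\<close> and can be
  subtracted.\<close>

lemma diff_ideal_shift:
  assumes I: "is_diff_ideal n m I" and l: "l < m"
    and mem: "g * (A * x - B * y) \<in> I" "deriv_l l g \<in> I" "deriv_l l A \<in> I" "deriv_l l B \<in> I"
    and dp: "g \<in> dpolys n m" "A \<in> dpolys n m" "B \<in> dpolys n m" "x \<in> dpolys n m" "y \<in> dpolys n m"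
  shows "g * (A * deriv_l l x - B * deriv_l l y) \<in> I"
proof -
  have "deriv_l l g * (A * x - B * y) + g * (deriv_l l A * x - deriv_l l B * y) \<in> I"
    by (intro diff_idealD[OF I] dpolys_diff dpolys_mult mem dp)
  then have "deriv_l l (g * (A * x - B * y))
      - (deriv_l l g * (A * x - B * y) + g * (deriv_l l A * x - deriv_l l B * y)) \<in> I"
    using diff_idealD(2)[OF I] diff_idealD(5)[OF I mem(1) l] by blast
  then show ?thesis by (simp add: deriv_product_difference)
qed

text \<open>State monomials are products of underived indeterminates. By \<open>antichain\<close>,
  within \<open>Q\<close> none of them divides that of another state, so a monomial cannot be read
  as a configuration in two different states.\<close>

locale state_encoding =
  fixes Q :: "'s set" and st :: "'s \<Rightarrow> dvar \<Rightarrow>\<^sub>0 nat"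
  assumes st_keys: "v \<in> Poly_Mapping.keys (st q) \<Longrightarrow> fst v < 4 \<and> snd v = 0"
    and antichain: "q \<in> Q \<Longrightarrow> q' \<in> Q \<Longrightarrow>
      (\<And>v. Poly_Mapping.lookup (st q) v \<le> Poly_Mapping.lookup (st q') v) \<Longrightarrow> q = q'"
begin

abbreviation S :: "'s \<Rightarrow> 'a::comm_ring_1 dpoly" where
  "S q \<equiv> Poly_Mapping.single (st q) 1"

definition gate0 :: "'s rule \<Rightarrow> 'a::comm_ring_1 dpoly" where
  "gate0 r = (if free0 r then 1 else dv (w0 0))"

definition gate1 :: "'s rule \<Rightarrow> 'a::comm_ring_1 dpoly" where
  "gate1 r = (if free1 r then 1 else dv (w1 0))"

fun head_poly :: "'s \<times> nat \<times> nat \<Rightarrow> 'a::comm_ring_1 dpoly" where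
  "head_poly (q, i, j) = S q * dv (xv i j)"

definition conf_poly :: "'s \<times> nat \<times> nat \<Rightarrow> 'a::comm_ring_1 dpoly" where
  "conf_poly c = dv (w0 0) * dv (w1 0) * head_poly c"

definition rule_poly :: "'s rule \<Rightarrow> nat \<Rightarrow> nat \<Rightarrow> 'a::comm_ring_1 dpoly" where
  "rule_poly r e f = gate0 r * gate1 r *
     (head_poly (shift_conf e f (src r)) - head_poly (shift_conf e f (tgt r)))"

text \<open>The state indeterminates become constants, and each gate becomes constant in the
  direction of the other counter. The gate of one counter is then no obstacle to differentiating a
  rule along the other.\<close>

definition constants_gens :: "nat \<Rightarrow> 'a::comm_ring_1 dpoly set" where
  "constants_gens m = (\<lambda>(l, i). dv (shift_var l (i, 0))) ` ({..<m} \<times> {..<4}) \<union>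
     {dv (shift_var 1 (w0 0)), dv (shift_var 0 (w1 0))}"

definition gens :: "nat \<Rightarrow> 's rule set \<Rightarrow> 'a::comm_ring_1 dpoly set" where
  "gens m Rs = constants_gens m \<union> (\<lambda>r. rule_poly r 0 0) ` Rs"

lemma dpolys_vars:
  assumes "m \<ge> 2"
  shows "dv (w0 k) \<in> dpolys 7 m" "dv (w1 k) \<in> dpolys 7 m" "dv (xv i j) \<in> dpolys 7 m"
proof -
  have "Poly_Mapping.keys (Poly_Mapping.single 0 i + Poly_Mapping.single (1::nat) j) \<subseteq> {..<m}"
    using keys_add[of "Poly_Mapping.single 0 i" "Poly_Mapping.single (1::nat) j"] assms
    by (auto split: if_splits)
  then show "dv (xv i j) \<in> dpolys 7 m" by (intro dpolys_dv) (auto simp: xv_def)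
qed (use assms in \<open>auto intro!: dpolys_dv simp: w0_def w1_def split: if_splits\<close>)

lemma dpolys_S: "Poly_Mapping.single (st q) c \<in> dpolys 7 m"
  using st_keys by (fastforce simp: dpolys_def split: if_splits)

lemma dpolys_gates: "m \<ge> 2 \<Longrightarrow> gate0 r \<in> dpolys 7 m" "m \<ge> 2 \<Longrightarrow> gate1 r \<in> dpolys 7 m"
  by (auto simp: gate0_def gate1_def dpolys_vars dpolys_1)

lemma dpolys_head: "m \<ge> 2 \<Longrightarrow> head_poly c \<in> dpolys 7 m"
  by (cases c) (auto intro!: dpolys_mult dpolys_S dpolys_vars)

lemma dpolys_conf: "m \<ge> 2 \<Longrightarrow> conf_poly c \<in> dpolys 7 m"
  by (auto simp: conf_poly_def intro!: dpolys_mult dpolys_head dpolys_vars)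

lemma dpolys_gens:
  assumes "m \<ge> 2"
  shows "gens m Rs \<subseteq> dpolys 7 m"
proof -
  have "dv (shift_var l (i, 0)) \<in> dpolys 7 m" if "l < m" "i < 4" for l i
    using that by (intro dpolys_dv) (auto simp: shift_var_def)
  moreover have "deriv_l 1 (dv (w0 0)) \<in> dpolys 7 m" "deriv_l 0 (dv (w1 0)) \<in> dpolys 7 m"
    using assms by (auto intro!: dpolys_deriv dpolys_vars)
  moreover have "rule_poly r 0 0 \<in> dpolys 7 m" for r
    unfolding rule_poly_def using assms
    by (intro dpolys_mult dpolys_diff dpolys_gates dpolys_head)
  ultimately show ?thesis by (auto simp: gens_def constants_gens_def deriv_l_dv)
qed

section \<open>Machine steps give elements of the differential ideal\<close>

context
  fixes m :: nat and Rs :: "'s rule set" and I :: "'a::comm_ring_1 dpoly set"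
  assumes m: "m \<ge> 2" and I: "is_diff_ideal 7 m I" and gens: "gens m Rs \<subseteq> I"
begin

lemma deriv_S_mem:
  assumes "l < m"
  shows "deriv_l l (S q) \<in> I"
  unfolding deriv_l_single deriv_mono_factor
proof (intro diff_ideal_sum[OF I] diff_idealD(3)[OF I])
  fix v assume v: "v \<in> Poly_Mapping.keys (st q)"
  then have "fst v < 4" "v = (fst v, 0)" using st_keys[OF v] by (auto simp: prod_eq_iff)
  then show "dv (shift_var l v) \<in> I"
    using gens assms unfolding gens_def constants_gens_def by force
  have "Poly_Mapping.keys (st q - Poly_Mapping.single v 1) \<subseteq> Poly_Mapping.keys (st q)"
    by (auto simp: in_keys_iff lookup_minus)
  then show "Poly_Mapping.single (st q - Poly_Mapping.single v 1)
      (1 * of_nat (Poly_Mapping.lookup (st q) v)) \<in> dpolys 7 m"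
    using st_keys by (fastforce simp: dpolys_def split: if_splits)
qed

lemma deriv_gates_mem: "deriv_l 0 (gate1 r) \<in> I" "deriv_l 1 (gate0 r) \<in> I"
proof -
  have "deriv_l l (1 :: 'a dpoly) = 0" for l
    using deriv_l_mult[of l 1 "1 :: 'a dpoly"] by simp
  then show "deriv_l 0 (gate1 r) \<in> I" "deriv_l 1 (gate0 r) \<in> I"
    using gens diff_idealD(7)[OF I]
    by (auto simp: gate0_def gate1_def deriv_l_dv gens_def constants_gens_def)
qed

text \<open>Along a free counter the rule's own gate is 1, while the other gate and the state
  monomials are constant modulo \<open>I\<close>. Thus \<open>diff_ideal_shift\<close> raises that
  counter by one on both sides; the induction runs over \<open>e\<close> first, then over
  \<open>f\<close>.\<close>

lemma rule_poly_mem: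
  assumes r: "r \<in> Rs" and "free0 r \<or> e = 0" "free1 r \<or> f = 0"
  shows "rule_poly r e f \<in> I"
proof -
  obtain s a b t c d where sr: "src r = (s, a, b)" "tgt r = (t, c, d)" by (metis prod_cases3)
  note dp = dpolys_mult dpolys_gates dpolys_S dpolys_vars m
  have e: "rule_poly r e 0 \<in> I" using assms(2)
  proof (induction e)
    case 0
    then show ?case using r gens by (auto simp: gens_def)
  next
    case (Suc e)
    then have fr: "gate0 r = (1 :: 'a dpoly)" by (simp add: gate0_def)
    have "gate0 r * gate1 r * (S s * deriv_l 0 (dv (xv (a + e) b)) - S t * deriv_l 0 (dv (xv (c + e) d))) \<in> I"
      using Suc m fr deriv_gates_mem
      by (intro diff_ideal_shift[OF I] deriv_S_mem dp) (auto simp: rule_poly_def sr)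
    then show ?case by (simp add: rule_poly_def sr deriv_l_dv shift_xv0)
  qed
  show ?thesis using assms(3)
  proof (induction f)
    case 0
    then show ?case using e by simp
  next
    case (Suc f)
    then have fr: "gate1 r = (1 :: 'a dpoly)" by (simp add: gate1_def)
    have "gate0 r * gate1 r * (S s * deriv_l 1 (dv (xv (a + e) (b + f))) - S t * deriv_l 1 (dv (xv (c + e) (d + f)))) \<in> I"
      using Suc m fr deriv_gates_mem
      by (intro diff_ideal_shift[OF I] deriv_S_mem dp) (auto simp: rule_poly_def sr)
    then show ?case by (simp add: rule_poly_def sr deriv_l_dv shift_xv1)
  qed
qed

lemma rule_step_mem:
  assumes "rule_step Rs c c'"
  shows "conf_poly c - conf_poly c' \<in> I"
proof -
  obtain r e f where r: "r \<in> Rs" "free0 r \<or> e = 0" "free1 r \<or> f = 0"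
    "c = shift_conf e f (src r)" "c' = shift_conf e f (tgt r)"
    using assms unfolding rule_step_def by blast
  \<comment> \<open>The rule carries gates only for the counters it tests exactly; \<open>k\<close>
    supplies the missing ones, since \<open>conf_poly\<close> has both.\<close>
  define k :: "'a dpoly" where
    "k = (if free0 r then dv (w0 0) else 1) * (if free1 r then dv (w1 0) else 1)"
  have "k * (gate0 r * gate1 r) = dv (w0 0) * dv (w1 0)"
    by (simp add: k_def gate0_def gate1_def)
  then have "conf_poly c - conf_poly c' = (k * (gate0 r * gate1 r)) * (head_poly c - head_poly c')"
    by (simp add: conf_poly_def right_diff_distrib)
  then have "conf_poly c - conf_poly c' = k * rule_poly r e f"
    by (simp only: rule_poly_def r(4,5) mult.assoc)
  moreover have "k \<in> dpolys 7 m"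
    unfolding k_def using m by (auto intro!: dpolys_mult dpolys_vars dpolys_1)
  ultimately show ?thesis using rule_poly_mem[OF r(1-3)] diff_idealD(3)[OF I] by simp
qed

lemma rule_steps_mem: "(rule_step Rs)\<^sup>*\<^sup>* c c' \<Longrightarrow> conf_poly c - conf_poly c' \<in> I"
proof (induction rule: rtranclp_induct)
  case (step y z)
  from diff_idealD(1)[OF I step.IH rule_step_mem[OF step.hyps(2)]] show ?case by simp
qed (simp add: diff_idealD(7)[OF I])

end

lemma rule_steps_gen:
  assumes "m \<ge> 2" "(rule_step Rs)\<^sup>*\<^sup>* c c'"
  shows "conf_poly c - conf_poly c' \<in> diff_ideal_gen 7 m (gens m Rs)"
  unfolding diff_ideal_gen_def using rule_steps_mem[OF assms(1) _ _ assms(2)] by blast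

section \<open>Recognition of configuration monomials\<close>

abbreviation mvar :: "dvar \<Rightarrow> dvar \<Rightarrow>\<^sub>0 nat" where
  "mvar v \<equiv> Poly_Mapping.single v 1"

definition conf_mono :: "'s \<Rightarrow> nat \<Rightarrow> nat \<Rightarrow> nat \<Rightarrow> nat \<Rightarrow> dvar \<Rightarrow>\<^sub>0 nat" where
  "conf_mono q a b i j = st q + mvar (w0 a) + mvar (w1 b) + mvar (xv i j)"

lemma lookup_st_0: "fst v \<ge> 4 \<Longrightarrow> Poly_Mapping.lookup (st q) v = 0"
  using st_keys[of v q] by (auto simp: in_keys_iff)

lemma lookup_conf_mono_cases:
  assumes "Poly_Mapping.lookup (conf_mono q a b i j) v \<noteq> 0"
  shows "v = w0 a \<or> v = w1 b \<or> v = xv i j \<or> fst v < 4 \<and> snd v = 0"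
  using assms st_keys[of v q]
  by (auto simp: conf_mono_def lookup_add lookup_single in_keys_iff when_def split: if_splits)

lemma conf_mono_good:
  assumes "t + mvar v = conf_mono q a b i j"
  shows "good v"
proof -
  have "Poly_Mapping.lookup (conf_mono q a b i j) v \<noteq> 0"
    unfolding assms[symmetric] by (simp add: lookup_add)
  from lookup_conf_mono_cases[OF this] show ?thesis
    by (auto simp: good_w0 good_w1 good_xv) (auto simp: good_def)
qed

lemma conf_mono_xv:
  assumes "t + mvar (xv i' j') = conf_mono q a b i j"
  shows "i' = i \<and> j' = j \<and> t = st q + mvar (w0 a) + mvar (w1 b)"
proof -
  have "Poly_Mapping.lookup (conf_mono q a b i j) (xv i' j') \<noteq> 0"
    unfolding assms[symmetric] by (simp add: lookup_add)
  from lookup_conf_mono_cases[OF this] have "xv i' j' = xv i j"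
    by (auto dest: arg_cong[where f = fst])
  then show ?thesis using assms by (simp add: xv_eq conf_mono_def)
qed

text \<open>The variables of index below 4 in a configuration monomial form exactly
  \<open>st q\<close>. Hence \<open>st s\<close> divides \<open>st q\<close>, and the antichain
  condition gives equality.\<close>

lemma conf_mono_state:
  assumes "t + st s + mvar (xv i' j') = conf_mono q a b i j" "s \<in> Q" "q \<in> Q"
  shows "s = q \<and> i' = i \<and> j' = j \<and> t = mvar (w0 a) + mvar (w1 b)"
proof -
  have *: "t + st s = st q + mvar (w0 a) + mvar (w1 b)" "i' = i" "j' = j"
    using conf_mono_xv[OF assms(1)] by auto
  have "Poly_Mapping.lookup (st s) v \<le> Poly_Mapping.lookup (st q) v" for v
  proof (cases "fst v < 4")
    case True
    then have "v \<noteq> w0 a" "v \<noteq> w1 b" by auto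
    then have "Poly_Mapping.lookup t v + Poly_Mapping.lookup (st s) v = Poly_Mapping.lookup (st q) v"
      using arg_cong[OF *(1), of "\<lambda>t. Poly_Mapping.lookup t v"]
      by (simp add: lookup_add lookup_single_not_eq)
    then show ?thesis by simp
  next
    case False
    then show ?thesis using lookup_st_0[of v s] by simp
  qed
  from antichain[OF assms(2,3) this] have "s = q" .
  moreover have "t + st s = (mvar (w0 a) + mvar (w1 b)) + st s"
    using *(1) unfolding calculation by (simp only: ac_simps)
  then have "t = mvar (w0 a) + mvar (w1 b)" by (rule add_right_imp_eq)
  ultimately show ?thesis using *(2,3) by blast
qed

lemma conf_mono_w0:
  assumes "t + mvar (w0 k) + mvar (xv i' j') = conf_mono q a b i j"
  shows "k = a \<and> i' = i \<and> j' = j \<and> t = st q + mvar (w1 b)"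
proof -
  have *: "t + mvar (w0 k) = st q + mvar (w0 a) + mvar (w1 b)" "i' = i" "j' = j"
    using conf_mono_xv[OF assms(1)] by auto
  have "Poly_Mapping.lookup (t + mvar (w0 k)) (w0 k) \<noteq> 0" by (simp add: lookup_add)
  then have "w0 k = w0 a"
    unfolding *(1) using lookup_st_0[of "w0 k" q]
    by (auto simp: lookup_add lookup_single when_def split: if_splits dest: arg_cong[where f = fst])
  then have "k = a" by (simp only: w0_eq)
  moreover have "t + mvar (w0 k) = (st q + mvar (w1 b)) + mvar (w0 k)"
    using *(1) unfolding calculation by (simp only: ac_simps)
  then have "t = st q + mvar (w1 b)" by (rule add_right_imp_eq)
  ultimately show ?thesis using *(2,3) by blast
qed

lemma conf_mono_w1:
  assumes "t + mvar (w1 k) + mvar (xv i' j') = conf_mono q a b i j"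
  shows "k = b \<and> i' = i \<and> j' = j \<and> t = st q + mvar (w0 a)"
proof -
  have *: "t + mvar (w1 k) = st q + mvar (w0 a) + mvar (w1 b)" "i' = i" "j' = j"
    using conf_mono_xv[OF assms(1)] by auto
  have "Poly_Mapping.lookup (t + mvar (w1 k)) (w1 k) \<noteq> 0" by (simp add: lookup_add)
  then have "w1 k = w1 b"
    unfolding *(1) using lookup_st_0[of "w1 k" q]
    by (auto simp: lookup_add lookup_single when_def split: if_splits dest: arg_cong[where f = fst])
  then have "k = b" by (simp only: w1_eq)
  moreover have "t + mvar (w1 k) = (st q + mvar (w0 a)) + mvar (w1 k)"
    using *(1) unfolding calculation by (simp only: ac_simps)
  then have "t = st q + mvar (w0 a)" by (rule add_right_imp_eq)
  ultimately show ?thesis using *(2,3) by blast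
qed

lemma w_mono_inj:
  assumes "mvar (w0 a) + mvar (w1 b) = mvar (w0 a') + mvar (w1 b')"
  shows "a = a' \<and> b = b'"
proof -
  have l: "Poly_Mapping.lookup (mvar (w0 x) + mvar (w1 y)) v \<noteq> 0 \<longleftrightarrow> v = w0 x \<or> v = w1 y" for x y v
    by (auto simp: lookup_add lookup_single when_def)
  have "w0 a = w0 a' \<or> w0 a = w1 b'" "w1 b = w0 a' \<or> w1 b = w1 b'"
    using l[of a b] unfolding assms l by blast+
  then show ?thesis by (auto simp: w0_eq w1_eq dest: arg_cong[where f = fst])
qed

lemma conf_mono_inj:
  assumes "conf_mono q a b i j = conf_mono q' a' b' i' j'" "q \<in> Q" "q' \<in> Q"
  shows "q = q' \<and> a = a' \<and> b = b' \<and> i = i' \<and> j = j'"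
proof -
  have "(mvar (w0 a) + mvar (w1 b)) + st q + mvar (xv i j) = conf_mono q' a' b' i' j'"
    unfolding assms(1)[symmetric] by (simp add: conf_mono_def ac_simps)
  from conf_mono_state[OF this assms(2,3)] show ?thesis using w_mono_inj by blast
qed

section \<open>The linear functional\<close>

context
  fixes \<chi> :: "'s \<times> nat \<times> nat \<Rightarrow> 'a::comm_ring_1"
begin

text \<open>Up to sign, a derivative of \<open>w\<close> is evaluated as the same derivative of the \<open>x\<close>-variable
  (integration by parts), so that every total derivative of \<open>w x\<close> is mapped to zero.\<close>
definition mono_val :: "(dvar \<Rightarrow>\<^sub>0 nat) \<Rightarrow> 'a" where
  "mono_val t = (if \<exists>q\<in>Q. \<exists>a b i j. t = conf_mono q a b i j
     then case SOME (q, a, b, i, j). q \<in> Q \<and> t = conf_mono q a b i j of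
       (q, a, b, i, j) \<Rightarrow> (- 1) ^ (a + b) * \<chi> (q, i + a, j + b)
     else 0)"

lemma mono_val_conf:
  assumes "q \<in> Q"
  shows "mono_val (conf_mono q a b i j) = (- 1) ^ (a + b) * \<chi> (q, i + a, j + b)"
proof -
  have "(SOME (q', a', b', i', j'). q' \<in> Q \<and> conf_mono q a b i j = conf_mono q' a' b' i' j') = (q, a, b, i, j)"
    using assms by (intro some_equality) (auto dest!: conf_mono_inj)
  moreover have "\<exists>q'\<in>Q. \<exists>a' b' i' j'. conf_mono q a b i j = conf_mono q' a' b' i' j'"
    using assms by blast
  ultimately show ?thesis unfolding mono_val_def by (simp only: if_True prod.case)
qed

lemma mono_val_0: "(\<And>q a b i j. q \<in> Q \<Longrightarrow> t \<noteq> conf_mono q a b i j) \<Longrightarrow> mono_val t = 0"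
  unfolding mono_val_def by auto

definition fnl :: "'a dpoly \<Rightarrow> 'a" where
  "fnl = lin_ext (\<lambda>t c. c * mono_val t)"

lemma fnl_add: "fnl (p + q) = fnl p + fnl q"
  unfolding fnl_def by (rule lin_ext_add) (simp add: distrib_right)

lemma fnl_single: "fnl (Poly_Mapping.single t c) = c * mono_val t"
  unfolding fnl_def by (rule lin_ext_single) simp

lemma fnl_0: "fnl 0 = 0"
  by (simp add: fnl_def lin_ext_def)

lemma fnl_diff: "fnl (p - q) = fnl p - fnl q"
  using fnl_add[of "p - q" q] by simp

text \<open>The functional is additive but not multiplicative, so the hypothesis covers all monomial
  multiples of the elements of \<open>B\<close>; a polynomial multiple is a sum of these.\<close>

lemma fnl_span:
  assumes "\<And>b t c. b \<in> B \<Longrightarrow> fnl (Poly_Mapping.single t c * b) = 0" "p \<in> ideal_span B"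
  shows "fnl p = 0"
  using assms(2)
proof (induction rule: ideal_span.induct)
  case (span_step b p r)
  have "fnl (r * b) = 0"
    by (induction r rule: poly_mapping_single_induct)
      (simp_all add: distrib_right fnl_add fnl_0 assms(1)[OF span_step.hyps(1)])
  then show ?case using span_step by (simp add: fnl_add)
qed (simp add: fnl_0)

lemma fnl_conf_poly: "q \<in> Q \<Longrightarrow> fnl (conf_poly (q, i, j)) = \<chi> (q, i, j)"
  using mono_val_conf[of q 0 0 i j]
  by (simp add: conf_poly_def dv_def mult_single fnl_single conf_mono_def ac_simps)

end

text \<open>An upper bound for the differential ideal, described without derivations: the ordinary
  ideal spanned by this set is stable. The total derivatives of products of a gate derivative and an
  \<open>x\<close>-variable are adjoined to absorb the derivatives of exact tests.\<close>

inductive_set basis :: "'s rule set \<Rightarrow> 'a::comm_ring_1 dpoly set" for Rs where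
  basis_bad: "\<not> good v \<Longrightarrow> dv v \<in> basis Rs"
| basis_rule: "r \<in> Rs \<Longrightarrow> free0 r \<or> k = 0 \<Longrightarrow> free1 r \<or> l = 0 \<Longrightarrow> rule_poly r k l \<in> basis Rs"
| basis_total0: "dv (w0 (Suc k)) * dv (xv i j) + dv (w0 k) * dv (xv (Suc i) j) \<in> basis Rs"
| basis_total1: "dv (w1 (Suc k)) * dv (xv i j) + dv (w1 k) * dv (xv i (Suc j)) \<in> basis Rs"

lemma span_bad: "\<not> good v \<Longrightarrow> dv v \<in> ideal_span (basis Rs)"
  by (intro span_base basis_bad)

lemma span_shift_bad:
  assumes "l \<notin> (if fst v = 4 then {0} else if fst v = 5 then {1} else if fst v = 6 then {0, 1} else {})"
  shows "deriv_l l (dv v) \<in> ideal_span (basis Rs)"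
  unfolding deriv_l_dv by (rule span_bad[OF shift_bad_new[OF assms]])

lemma span_deriv_S: "deriv_l l (S q) \<in> ideal_span (basis Rs)"
  unfolding deriv_l_single deriv_mono_factor
proof (intro span_sum span_mult)
  fix v assume "v \<in> Poly_Mapping.keys (st q)"
  from st_keys[OF this] show "dv (shift_var l v) \<in> ideal_span (basis Rs)"
    by (intro span_bad shift_bad_new) auto
qed

lemma deriv_1: "deriv_l l (1 :: 'a::comm_ring_1 dpoly) = 0"
  using deriv_l_mult[of l 1 "1 :: 'a dpoly"] by simp

lemma span_deriv_gate0: "l \<noteq> 0 \<or> free0 r \<Longrightarrow> deriv_l l (gate0 r) \<in> ideal_span (basis Rs)"
  by (auto simp: gate0_def deriv_1 span_zero intro!: span_shift_bad)

lemma span_deriv_gate1: "l \<noteq> 1 \<or> free1 r \<Longrightarrow> deriv_l l (gate1 r) \<in> ideal_span (basis Rs)"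
  by (auto simp: gate1_def deriv_1 span_zero intro!: span_shift_bad)

text \<open>The derivative of a gate \<open>w\<close> need not lie in the span. It is paired here
  with those of \<open>x\<close> and \<open>y\<close> into the total derivatives of
  \<open>w * x\<close> and \<open>w * y\<close>, which do.\<close>

lemma deriv_gated_difference:
  "deriv_l l (w * h * (A * x - B * y)) =
     h * A * (deriv_l l w * x + w * deriv_l l x) - h * B * (deriv_l l w * y + w * deriv_l l y)
     + deriv_l l h * (w * (A * x - B * y)) + w * h * (deriv_l l A * x - deriv_l l B * y)"
  by (simp add: deriv_l_mult deriv_l_diff algebra_simps)

text \<open>For \<open>l >= 2\<close> all factors differentiate into the span. Along a free counter
  the main term is the next instance of the same rule. Along a counter tested exactly the derivative
  of the gate survives and \<open>deriv_gated_difference\<close> applies.\<close>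

lemma deriv_rule_poly:
  assumes "r \<in> Rs" "free0 r \<or> k = 0" "free1 r \<or> f = 0"
  shows "deriv_l l (rule_poly r k f) \<in> ideal_span (basis Rs :: 'a::comm_ring_1 dpoly set)"
proof -
  obtain s a b t c d where sr: "src r = (s, a, b)" "tgt r = (t, c, d)" by (metis prod_cases3)
  let ?B = "basis Rs :: 'a dpoly set"
  let ?x = "dv (xv (a + k) (b + f)) :: 'a dpoly" and ?y = "dv (xv (c + k) (d + f)) :: 'a dpoly"
  have p: "rule_poly r k f = gate0 r * gate1 r * (S s * ?x - S t * ?y)"
    by (simp add: rule_poly_def sr)
  have D: "g * (deriv_l l (S s) * x - deriv_l l (S t) * y) \<in> ideal_span ?B" for g x y
    by (intro span_mult span_diff span_mult_right[OF span_deriv_S])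
  consider "l \<ge> 2" | "l = 0" "free0 r" | "l = 0" "\<not> free0 r" | "l = 1" "free1 r" | "l = 1" "\<not> free1 r"
    by linarith
  then show ?thesis
  proof cases
    case 1
    have "deriv_l l (gate0 r * gate1 r) \<in> ideal_span ?B"
      unfolding deriv_l_mult using 1
      by (intro span_add span_mult span_mult_right span_deriv_gate0 span_deriv_gate1) auto
    then show ?thesis unfolding p deriv_product_difference using 1
      by (intro span_add span_diff span_mult_right[OF span_deriv_S] span_mult[OF span_shift_bad]
          span_mult span_mult_right[of "deriv_l l (gate0 r * gate1 r)"]) auto
  next
    case 2
    have g: "deriv_l l (gate0 r * gate1 r) \<in> ideal_span ?B"
      unfolding deriv_l_mult using 2
      by (intro span_add span_mult span_mult_right span_deriv_gate0 span_deriv_gate1) auto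
    have "rule_poly r (Suc k) f \<in> ?B" using assms 2 by (intro basis_rule) auto
    then have "gate0 r * gate1 r * (S s * deriv_l l ?x - S t * deriv_l l ?y) \<in> ideal_span ?B"
      using 2 span_base by (simp add: rule_poly_def sr deriv_l_dv shift_xv0)
    then show ?thesis unfolding p deriv_product_difference by (intro span_add span_mult_right[OF g] D)
  next
    case 3
    have w: "gate0 r = (dv (w0 0) :: 'a dpoly)" using 3 by (simp add: gate0_def)
    have T: "deriv_l l (dv (w0 0)) * dv (xv i j) + dv (w0 0) * deriv_l l (dv (xv i j)) \<in> ideal_span ?B" for i j
      using 3 span_base[OF basis_total0] by (simp add: deriv_l_dv shift_w0 shift_xv0)
    show ?thesis unfolding p w deriv_gated_difference using 3
      by (intro span_add[of "_ + _"] span_add[of "_ - _"] span_diff[OF span_mult[OF T] span_mult[OF T]]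
          span_mult_right[OF span_deriv_gate1] D) auto
  next
    case 4
    have g: "deriv_l l (gate0 r * gate1 r) \<in> ideal_span ?B"
      unfolding deriv_l_mult using 4
      by (intro span_add span_mult span_mult_right span_deriv_gate0 span_deriv_gate1) auto
    have "rule_poly r k (Suc f) \<in> ?B" using assms 4 by (intro basis_rule) auto
    then have "gate0 r * gate1 r * (S s * deriv_l l ?x - S t * deriv_l l ?y) \<in> ideal_span ?B"
      using 4 span_base by (simp add: rule_poly_def sr deriv_l_dv shift_xv1)
    then show ?thesis unfolding p deriv_product_difference by (intro span_add span_mult_right[OF g] D)
  next
    case 5
    have w: "gate0 r * gate1 r = (dv (w1 0) * gate0 r :: 'a dpoly)"
      using 5 by (simp add: gate1_def mult.commute)
    have T: "deriv_l l (dv (w1 0)) * dv (xv i j) + dv (w1 0) * deriv_l l (dv (xv i j)) \<in> ideal_span ?B" for i j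
      using 5 span_base[OF basis_total1] by (simp add: deriv_l_dv shift_w1 shift_xv1)
    show ?thesis unfolding p w deriv_gated_difference using 5
      by (intro span_add[of "_ + _"] span_add[of "_ - _"] span_diff[OF span_mult[OF T] span_mult[OF T]]
          span_mult_right[OF span_deriv_gate0] D) auto
  qed
qed

lemma deriv_product_sum:
  "deriv_l l (x * y + x' * y') = (deriv_l l x * y + x * deriv_l l y) + (deriv_l l x' * y' + x' * deriv_l l y')"
  by (simp add: deriv_l_add deriv_l_mult)

text \<open>Along \<open>delta_0\<close> a total derivative splits into two others with raised
  indices. Along \<open>delta_1\<close> the gate derivatives are constant modulo bad variables,
  which leaves the total derivative for the shifted \<open>x\<close>.\<close>

lemma deriv_total0:
  "deriv_l l (dv (w0 (Suc k)) * dv (xv i j) + dv (w0 k) * dv (xv (Suc i) j))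
     \<in> ideal_span (basis Rs :: 'a::comm_ring_1 dpoly set)"
proof -
  let ?T = "\<lambda>k i j. dv (w0 (Suc k)) * dv (xv i j) + dv (w0 k) * dv (xv (Suc i) j) :: 'a dpoly"
  let ?I = "ideal_span (basis Rs) :: 'a dpoly set"
  have T: "?T k i j \<in> ?I" for k i j by (intro span_base basis_total0)
  consider "l \<ge> 2" | "l = 0" | "l = 1" by linarith
  then show ?thesis
  proof cases
    case 1
    then show ?thesis unfolding deriv_product_sum
      by (intro span_add span_mult span_mult_right span_shift_bad) auto
  next
    case 2
    have "deriv_l l (?T k i j) = ?T (Suc k) i j + ?T k (Suc i) j"
      unfolding 2 deriv_product_sum deriv_l_dv shift_w0 shift_xv0 by (simp add: add_ac)
    then show ?thesis using T span_add by metis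
  next
    case 3
    have "deriv_l l (?T k i j) = (deriv_l l (dv (w0 (Suc k))) * dv (xv i j)
        + deriv_l l (dv (w0 k)) * dv (xv (Suc i) j)) + ?T k i (Suc j)"
      unfolding deriv_product_sum using 3 by (simp add: deriv_l_dv shift_xv1 add_ac)
    moreover have "\<dots> \<in> ?I" using 3
      by (intro span_add[OF _ T] span_add span_mult_right span_shift_bad) auto
    ultimately show ?thesis by simp
  qed
qed

lemma deriv_total1:
  "deriv_l l (dv (w1 (Suc k)) * dv (xv i j) + dv (w1 k) * dv (xv i (Suc j)))
     \<in> ideal_span (basis Rs :: 'a::comm_ring_1 dpoly set)"
proof -
  let ?T = "\<lambda>k i j. dv (w1 (Suc k)) * dv (xv i j) + dv (w1 k) * dv (xv i (Suc j)) :: 'a dpoly"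
  let ?I = "ideal_span (basis Rs) :: 'a dpoly set"
  have T: "?T k i j \<in> ?I" for k i j by (intro span_base basis_total1)
  consider "l \<ge> 2" | "l = 1" | "l = 0" by linarith
  then show ?thesis
  proof cases
    case 1
    then show ?thesis unfolding deriv_product_sum
      by (intro span_add span_mult span_mult_right span_shift_bad) auto
  next
    case 2
    have "deriv_l l (?T k i j) = ?T (Suc k) i j + ?T k i (Suc j)"
      unfolding deriv_product_sum using 2 by (simp add: deriv_l_dv shift_w1 shift_xv1 add_ac)
    then show ?thesis using T span_add by metis
  next
    case 3
    have "deriv_l l (?T k i j) = (deriv_l l (dv (w1 (Suc k))) * dv (xv i j)
        + deriv_l l (dv (w1 k)) * dv (xv i (Suc j))) + ?T k (Suc i) j"
      unfolding deriv_product_sum using 3 by (simp add: deriv_l_dv shift_xv0 add_ac)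
    moreover have "\<dots> \<in> ?I" using 3
      by (intro span_add[OF _ T] span_add span_mult_right span_shift_bad) auto
    ultimately show ?thesis by simp
  qed
qed

lemma deriv_basis: "b \<in> basis Rs \<Longrightarrow> deriv_l l b \<in> ideal_span (basis Rs)"
  by (induction rule: basis.induct)
    (simp_all add: deriv_l_dv span_bad shift_bad deriv_rule_poly deriv_total0 deriv_total1)

lemma gens_span: "gens m Rs \<subseteq> ideal_span (basis Rs)"
proof -
  have "dv (shift_var l (i, 0)) \<in> ideal_span (basis Rs)" if "i < 4" for l i
    using that by (intro span_bad shift_bad_new) auto
  moreover have "dv (shift_var 1 (w0 0)) \<in> ideal_span (basis Rs)" "dv (shift_var 0 (w1 0)) \<in> ideal_span (basis Rs)"
    by (intro span_bad shift_bad_new; simp)+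
  moreover have "rule_poly r 0 0 \<in> ideal_span (basis Rs)" if "r \<in> Rs" for r
    using that by (intro span_base basis_rule) auto
  ultimately show ?thesis by (auto simp: gens_def constants_gens_def)
qed

lemma diff_ideal_gen_span:
  assumes "m \<ge> 2"
  shows "diff_ideal_gen 7 m (gens m Rs) \<subseteq> ideal_span (basis Rs)"
proof -
  let ?I = "ideal_span (basis Rs) \<inter> dpolys 7 m"
  have "is_diff_ideal 7 m ?I"
    unfolding is_diff_ideal_def
    by (auto intro: span_zero span_add span_mult dpolys_0 dpolys_add dpolys_mult dpolys_deriv
        span_deriv[OF deriv_basis])
  moreover have "gens m Rs \<subseteq> ?I" using gens_span dpolys_gens[OF assms] by blast
  ultimately show ?thesis unfolding diff_ideal_gen_def by blast
qed

section \<open>Vanishing of the functional on the ideal\<close>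

definition rules_in :: "'s rule set \<Rightarrow> bool" where
  "rules_in Rs \<longleftrightarrow> (\<forall>r\<in>Rs. fst (src r) \<in> Q \<and> fst (tgt r) \<in> Q)"

text \<open>A bad variable divides no configuration monomial. The two monomials from a rule are both
  configurations or both not. In a total derivative the two monomials have the same shifted counters
  and opposite signs.\<close>

lemma fnl_basis:
  fixes \<chi> :: "'s \<times> nat \<times> nat \<Rightarrow> 'a::comm_ring_1"
  assumes "rules_in Rs" "\<And>c c'. rule_step Rs c c' \<Longrightarrow> \<chi> c = \<chi> c'" "b \<in> basis Rs"
  shows "fnl \<chi> (Poly_Mapping.single u z * b) = 0"
  using assms(3)
proof cases
  case (basis_bad v)
  have "mono_val \<chi> (u + mvar v) = 0"
    using conf_mono_good basis_bad by (intro mono_val_0) blast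
  then show ?thesis by (simp add: basis_bad dv_def mult_single fnl_single)
next
  case (basis_rule r k f)
  obtain s a b t c d where sr: "src r = (s, a, b)" "tgt r = (t, c, d)" by (metis prod_cases3)
  have Q: "s \<in> Q" "t \<in> Q" using assms(1) basis_rule(2) sr by (auto simp: rules_in_def)
  define g where "g = (if free0 r then 0 else mvar (w0 0)) + (if free1 r then 0 else mvar (w1 0))"
  have g: "gate0 r * gate1 r = Poly_Mapping.single g (1::'a)"
    by (simp add: gate0_def gate1_def g_def dv_def mult_single)
  have "fnl \<chi> (Poly_Mapping.single u z * rule_poly r k f) =
      z * mono_val \<chi> (u + g + st s + mvar (xv (a + k) (b + f))) - z * mono_val \<chi> (u + g + st t + mvar (xv (c + k) (d + f)))"
    unfolding rule_poly_def g
    by (simp add: sr dv_def right_diff_distrib fnl_diff mult_single fnl_single ac_simps)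
  also have "mono_val \<chi> (u + g + st s + mvar (xv (a + k) (b + f))) = mono_val \<chi> (u + g + st t + mvar (xv (c + k) (d + f)))"
  proof (cases "\<exists>a b. u + g = mvar (w0 a) + mvar (w1 b)")
    case True
    then obtain p q where pq: "u + g = mvar (w0 p) + mvar (w1 q)" by blast
    have l: "Poly_Mapping.lookup (mvar (w0 p) + mvar (w1 q)) v \<noteq> 0 \<Longrightarrow> v = w0 p \<or> v = w1 q" for v
      by (auto simp: lookup_add lookup_single when_def split: if_splits)
    \<comment> \<open>If the rule tests the first counter exactly, its gate \<open>w0 0\<close>
      divides the product, so the only derivative of \<open>w0\<close> present is the
      zeroth.\<close>
    have p0: "free0 r \<or> p = 0"
    proof (rule disjCI)
      assume "p \<noteq> 0"
      show "free0 r"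
      proof (rule ccontr)
        assume "\<not> free0 r"
        then have "Poly_Mapping.lookup (u + g) (w0 0) \<noteq> 0" by (simp add: g_def lookup_add)
        then have "w0 0 = w0 p \<or> w0 0 = w1 q" unfolding pq by (rule l)
        then show False using \<open>p \<noteq> 0\<close> by (auto simp: w0_eq dest: arg_cong[where f = fst])
      qed
    qed
    have q0: "free1 r \<or> q = 0"
    proof (rule disjCI)
      assume "q \<noteq> 0"
      show "free1 r"
      proof (rule ccontr)
        assume "\<not> free1 r"
        then have "Poly_Mapping.lookup (u + g) (w1 0) \<noteq> 0" by (simp add: g_def lookup_add)
        then have "w1 0 = w0 p \<or> w1 0 = w1 q" unfolding pq by (rule l)
        then show False using \<open>q \<noteq> 0\<close> by (auto simp: w1_eq dest: arg_cong[where f = fst])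
      qed
    qed
    \<comment> \<open>The functional reads the orders \<open>p\<close> and \<open>q\<close> as
      further increments of the counters. By \<open>p0\<close> and \<open>q0\<close> a counter
      tested exactly gets none, so the shifted pair is a genuine machine step.\<close>
    have "rule_step Rs (shift_conf (k + p) (f + q) (src r)) (shift_conf (k + p) (f + q) (tgt r))"
      unfolding rule_step_def using basis_rule p0 q0 by blast
    then have "\<chi> (s, a + k + p, b + f + q) = \<chi> (t, c + k + p, d + f + q)"
      using assms(2) by (simp add: sr add.assoc)
    moreover have "u + g + st s + mvar (xv i j) = conf_mono s p q i j" for s i j
      unfolding pq conf_mono_def by (simp add: ac_simps)
    ultimately show ?thesis using Q by (simp add: mono_val_conf)
  next
    case False
    then have "mono_val \<chi> (u + g + st s + mvar (xv i j)) = 0" if "s \<in> Q" for s i j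
      using conf_mono_state that by (intro mono_val_0) blast
    then show ?thesis using Q by simp
  qed
  finally show ?thesis by (simp add: basis_rule)
next
  case (basis_total0 k i j)
  have "mono_val \<chi> (u + mvar (w0 (Suc k)) + mvar (xv i j)) + mono_val \<chi> (u + mvar (w0 k) + mvar (xv (Suc i) j)) = 0"
  proof (cases "\<exists>q\<in>Q. \<exists>b. u = st q + mvar (w1 b)")
    case True
    then obtain q b where q: "q \<in> Q" "u = st q + mvar (w1 b)" by blast
    then have "u + mvar (w0 a) + mvar (xv i j) = conf_mono q a b i j" for a i j
      by (simp add: conf_mono_def ac_simps)
    then show ?thesis using q(1) by (simp add: mono_val_conf)
  next
    case False
    then have "mono_val \<chi> (u + mvar (w0 a) + mvar (xv i j)) = 0" for a i j
      using conf_mono_w0 by (intro mono_val_0) blast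
    then show ?thesis by simp
  qed
  then have "z * mono_val \<chi> (u + mvar (w0 (Suc k)) + mvar (xv i j)) + z * mono_val \<chi> (u + mvar (w0 k) + mvar (xv (Suc i) j)) = 0"
    by (simp flip: distrib_left)
  then show ?thesis
    by (simp add: basis_total0 dv_def distrib_left fnl_add mult_single fnl_single add.assoc)
next
  case (basis_total1 k i j)
  have "mono_val \<chi> (u + mvar (w1 (Suc k)) + mvar (xv i j)) + mono_val \<chi> (u + mvar (w1 k) + mvar (xv i (Suc j))) = 0"
  proof (cases "\<exists>q\<in>Q. \<exists>a. u = st q + mvar (w0 a)")
    case True
    then obtain q a where q: "q \<in> Q" "u = st q + mvar (w0 a)" by blast
    then have "u + mvar (w1 b) + mvar (xv i j) = conf_mono q a b i j" for b i j
      by (simp add: conf_mono_def ac_simps)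
    then show ?thesis using q(1) by (simp add: mono_val_conf)
  next
    case False
    then have "mono_val \<chi> (u + mvar (w1 b) + mvar (xv i j)) = 0" for b i j
      using conf_mono_w1 by (intro mono_val_0) blast
    then show ?thesis by simp
  qed
  then have "z * mono_val \<chi> (u + mvar (w1 (Suc k)) + mvar (xv i j)) + z * mono_val \<chi> (u + mvar (w1 k) + mvar (xv i (Suc j))) = 0"
    by (simp flip: distrib_left)
  then show ?thesis
    by (simp add: basis_total1 dv_def distrib_left fnl_add mult_single fnl_single add.assoc)
qed

lemma gen_invariant:
  fixes \<chi> :: "'s \<times> nat \<times> nat \<Rightarrow> 'a::comm_ring_1"
  assumes "m \<ge> 2" "rules_in Rs" "\<And>c c'. rule_step Rs c c' \<Longrightarrow> \<chi> c = \<chi> c'" "fst c \<in> Q" "fst c' \<in> Q"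
    "conf_poly c - conf_poly c' \<in> diff_ideal_gen 7 m (gens m Rs :: 'a dpoly set)"
  shows "\<chi> c = \<chi> c'"
proof -
  have "fnl \<chi> (conf_poly c - conf_poly c') = 0"
    using diff_ideal_gen_span[OF assms(1)] assms(6)
    by (intro fnl_span[OF fnl_basis[OF assms(2,3)]]) auto
  then show ?thesis
    using assms(4,5) by (cases c; cases c') (simp add: fnl_diff fnl_conf_poly)
qed

end

section \<open>Collatz machines simulated with two counters\<close>

text \<open>The second counter collects the quotient of the division by the row length; the remainder \<open>r\<close> is
  remembered as state component \<open>Suc r\<close>.\<close>
inductive_set collatz_rules :: "collatz_prog \<Rightarrow> (nat \<times> nat) rule set" for P where
  drain: "k < length P \<Longrightarrow> P ! k \<noteq> [] \<Longrightarrow>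
    Rule True True ((k, 0), length (P ! k), 0) ((k, 0), 0, 1) \<in> collatz_rules P"
| remainder: "k < length P \<Longrightarrow> r < length (P ! k) \<Longrightarrow>
    Rule False True ((k, 0), r, 0) ((k, Suc r), 0, 0) \<in> collatz_rules P"
| refill: "k < length P \<Longrightarrow> r < length (P ! k) \<Longrightarrow> P ! k ! r = (a, b, t) \<Longrightarrow>
    Rule True True ((k, Suc r), 0, 1) ((k, Suc r), a, 0) \<in> collatz_rules P"
| jump: "k < length P \<Longrightarrow> r < length (P ! k) \<Longrightarrow> P ! k ! r = (a, b, t) \<Longrightarrow>
    Rule True False ((k, Suc r), 0, 0) ((t, 0), b, 0) \<in> collatz_rules P"

lemma finite_collatz_rules: "finite (collatz_rules P)"
proof -
  define K where "K = (SIGMA k:{..<length P}. {..<length (P ! k)})"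
  define F where "F = (\<lambda>k. Rule True True ((k, 0::nat), length (P ! k), 0::nat) ((k, 0::nat), 0::nat, 1::nat))"
  define G1 where "G1 = (\<lambda>(k::nat, r). Rule False True ((k, 0::nat), r, 0::nat) ((k, Suc r), 0::nat, 0::nat))"
  define G2 where "G2 = (\<lambda>(k::nat, r). Rule True True ((k, Suc r), 0::nat, 1::nat) ((k, Suc r), fst (P ! k ! r), 0::nat))"
  define G3 where "G3 = (\<lambda>(k::nat, r). Rule True False ((k, Suc r), 0::nat, 0::nat)
    ((snd (snd (P ! k ! r)), 0::nat), fst (snd (P ! k ! r)), 0::nat))"
  have "x \<in> F ` {..<length P} \<union> G1 ` K \<union> G2 ` K \<union> G3 ` K" if "x \<in> collatz_rules P" for x
    using that
  proof cases
    case (drain k)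
    then have "x \<in> F ` {..<length P}" by (intro image_eqI[of _ _ k]) (simp_all add: F_def)
    then show ?thesis by blast
  next
    case (remainder k r)
    then have "x \<in> G1 ` K" by (intro image_eqI[of _ _ "(k, r)"]) (simp_all add: G1_def K_def)
    then show ?thesis by blast
  next
    case (refill k r a b t)
    then have "x \<in> G2 ` K" by (intro image_eqI[of _ _ "(k, r)"]) (simp_all add: G2_def K_def)
    then show ?thesis by blast
  next
    case (jump k r a b t)
    then have "x \<in> G3 ` K" by (intro image_eqI[of _ _ "(k, r)"]) (simp_all add: G3_def K_def)
    then show ?thesis by blast
  qed
  then have "collatz_rules P \<subseteq> F ` {..<length P} \<union> G1 ` K \<union> G2 ` K \<union> G3 ` K" by blast
  moreover have "finite K" by (simp add: K_def)
  ultimately show ?thesis by (meson finite_UnI finite_imageI finite_lessThan finite_subset)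
qed

lemma rule_step_collatz_iff:
  "rule_step (collatz_rules P) ((k, x), i, j) d \<longleftrightarrow> k < length P \<and> P ! k \<noteq> [] \<and>
     (x = 0 \<and> i \<ge> length (P ! k) \<and> d = ((k, 0), i - length (P ! k), Suc j) \<or>
      x = 0 \<and> i < length (P ! k) \<and> d = ((k, Suc i), 0, j) \<or>
      (\<exists>r a b t. x = Suc r \<and> r < length (P ! k) \<and> P ! k ! r = (a, b, t) \<and>
        (j > 0 \<and> d = ((k, x), i + a, j - 1) \<or> j = 0 \<and> d = ((t, 0), i + b, 0))))"
  (is "?L \<longleftrightarrow> ?R")
proof
  assume ?L
  then obtain r e f where r: "r \<in> collatz_rules P" "free0 r \<or> e = 0" "free1 r \<or> f = 0"
    "((k, x), i, j) = shift_conf e f (src r)" "d = shift_conf e f (tgt r)"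
    unfolding rule_step_def by blast
  from r(1) show ?R
    by cases (use r(2-5) in auto)
next
  assume R: ?R
  then have k: "k < length P" "P ! k \<noteq> []" by auto
  from R consider
      (1) "x = 0" "i \<ge> length (P ! k)" "d = ((k, 0), i - length (P ! k), Suc j)"
    | (2) "x = 0" "i < length (P ! k)" "d = ((k, Suc i), 0, j)"
    | (3) r a b t where "x = Suc r" "r < length (P ! k)" "P ! k ! r = (a, b, t)" "j > 0" "d = ((k, x), i + a, j - 1)"
    | (4) r a b t where "x = Suc r" "r < length (P ! k)" "P ! k ! r = (a, b, t)" "j = 0" "d = ((t, 0), i + b, 0)"
    by blast
  then show ?L
  proof cases
    case 1
    then show ?thesis unfolding rule_step_def
      by (intro bexI[OF _ drain[OF k]] exI[of _ "i - length (P ! k)"] exI[of _ j]) auto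
  next
    case 2
    then show ?thesis unfolding rule_step_def
      by (intro bexI[OF _ remainder[OF k(1) 2(2)]] exI[of _ 0] exI[of _ j]) auto
  next
    case 3
    then show ?thesis unfolding rule_step_def
      by (intro bexI[OF _ refill[OF k(1) 3(2,3)]] exI[of _ i] exI[of _ "j - 1"]) auto
  next
    case 4
    then show ?thesis unfolding rule_step_def
      by (intro bexI[OF _ jump[OF k(1) 4(2,3)]] exI[of _ i] exI[of _ 0]) auto
  qed
qed

text \<open>Drain and remainder are separated by comparing the first counter with the row length,
  refill and jump by whether the second counter is zero.\<close>

lemma rule_step_collatz_det:
  "rule_step (collatz_rules P) c d \<Longrightarrow> rule_step (collatz_rules P) c d' \<Longrightarrow> d = d'"
  by (cases c, cases "fst c") (auto simp: rule_step_collatz_iff)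

text \<open>For a number \<open>p * q + r\<close>, draining moves \<open>q\<close> to the second
  counter, \<open>r\<close> enters the state, refilling turns \<open>q\<close> into
  \<open>a * q\<close>, and the jump adds \<open>b\<close>.\<close>

lemma collatz_step_rules:
  assumes "collatz_step P (k, N) (t, N')"
  shows "(rule_step (collatz_rules P))\<^sup>*\<^sup>* ((k, 0), N, 0) ((t, 0), N', 0)"
proof -
  let ?p = "length (P ! k)" and ?s = "rule_step (collatz_rules P)"
  let ?r = "N mod ?p" and ?q = "N div ?p"
  obtain a b where k: "k < length P" "P ! k \<noteq> []" and row: "P ! k ! ?r = (a, b, t)" "N' = a * ?q + b"
    using assms by (auto simp: collatz_step_def split: prod.splits)
  have r: "?r < ?p" using k by simp
  have 1: "?s\<^sup>*\<^sup>* ((k, 0), q * ?p + i, j) ((k, 0), i, j + q)" for q i j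
  proof (induction q arbitrary: j)
    case (Suc q)
    have "?s ((k, 0), Suc q * ?p + i, j) ((k, 0), q * ?p + i, Suc j)"
      using k by (simp add: rule_step_collatz_iff)
    with Suc[of "Suc j"] show ?case by (simp add: converse_rtranclp_into_rtranclp)
  qed simp
  have 2: "?s ((k, 0), ?r, ?q) ((k, Suc ?r), 0, ?q)"
    using k r by (simp add: rule_step_collatz_iff)
  have 3: "?s\<^sup>*\<^sup>* ((k, Suc ?r), i, j) ((k, Suc ?r), i + a * j, 0)" for i j
  proof (induction j arbitrary: i)
    case (Suc j)
    have "?s ((k, Suc ?r), i, Suc j) ((k, Suc ?r), i + a, j)"
      using k r row(1) by (simp add: rule_step_collatz_iff)
    with Suc[of "i + a"] show ?case by (simp add: converse_rtranclp_into_rtranclp add.assoc)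
  qed simp
  have 4: "?s ((k, Suc ?r), a * ?q, 0) ((t, 0), N', 0)"
    using k r row by (simp add: rule_step_collatz_iff)
  have "?s\<^sup>*\<^sup>* ((k, 0), N, 0) ((k, 0), ?r, ?q)" using 1[of ?q ?r 0] by simp
  also have "?s\<^sup>*\<^sup>* ((k, 0), ?r, ?q) ((k, Suc ?r), 0, ?q)" using 2 by blast
  also have "?s\<^sup>*\<^sup>* ((k, Suc ?r), 0, ?q) ((k, Suc ?r), a * ?q, 0)" using 3[of 0 ?q] by simp
  also have "?s\<^sup>*\<^sup>* ((k, Suc ?r), a * ?q, 0) ((t, 0), N', 0)" using 4 by blast
  finally show ?thesis .
qed

lemma collatz_steps_rules:
  "(collatz_step P)\<^sup>*\<^sup>* c c' \<Longrightarrow>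
     (rule_step (collatz_rules P))\<^sup>*\<^sup>* ((fst c, 0), snd c, 0) ((fst c', 0), snd c', 0)"
proof (induction rule: rtranclp_induct)
  case (step y z)
  then show ?case using collatz_step_rules[of P "fst y" "snd y" "fst z" "snd z"] by simp
qed simp

lemma rule_step_collatz_stuck: "\<not> rule_step (collatz_rules P) ((length P, x), i, j) d"
  by (simp add: rule_step_collatz_iff)

lemma deterministic_stuck_unique:
  assumes det: "\<And>a b b'. r a b \<Longrightarrow> r a b' \<Longrightarrow> b = b'"
    and "r\<^sup>*\<^sup>* a x" "r\<^sup>*\<^sup>* a y" "\<And>z. \<not> r x z" "\<And>z. \<not> r y z"
  shows "x = y"
  using assms(2,3)
proof (induction rule: converse_rtranclp_induct)
  case base
  then show ?case using assms(4) by (metis converse_rtranclpE)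
next
  case (step a b)
  then have "r\<^sup>*\<^sup>* b y" using assms(5) det by (metis converse_rtranclpE)
  with step.IH show ?case .
qed

text \<open>As the target is stuck, a run from \<open>a\<close> to it is not empty and passes
  through the unique successor \<open>b\<close>. Hence the indicator of reaching a halting
  configuration is invariant under steps.\<close>

lemma deterministic_reach_iff:
  assumes det: "\<And>a b b'. r a b \<Longrightarrow> r a b' \<Longrightarrow> b = b'"
    and "r a b" "\<And>z. \<not> r x z"
  shows "r\<^sup>*\<^sup>* a x \<longleftrightarrow> r\<^sup>*\<^sup>* b x"
  using assms by (metis converse_rtranclpE converse_rtranclp_into_rtranclp)

text \<open>The exponents of the constants 2 and 3 add up to \<open>M\<close>, which makes the codes of different
  states incomparable.  The initial and the final state have codes independent of the program.\<close>
definition state_mono :: "nat \<Rightarrow> nat \<Rightarrow> nat \<times> nat \<Rightarrow> dvar \<Rightarrow>\<^sub>0 nat" where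
  "state_mono M L q = (if q = (0, 0) then Poly_Mapping.single (0, 0) 1
     else if q = (L, 0) then Poly_Mapping.single (1, 0) 1
     else Poly_Mapping.single (2, 0) (prod_encode q) + Poly_Mapping.single (3, 0) (M - prod_encode q))"

lemma prod_encode_0: "prod_encode q = 0 \<longleftrightarrow> q = (0, 0)"
proof -
  have "prod_encode (0, 0) = 0" by (simp add: prod_encode_def)
  then show ?thesis using prod_encode_eq[of q "(0, 0)"] by simp
qed

lemma lookup_state_mono:
  "Poly_Mapping.lookup (state_mono M L q) (0, 0) = (if q = (0, 0) then 1 else 0)"
  "Poly_Mapping.lookup (state_mono M L q) (1, 0) = (if q \<noteq> (0, 0) \<and> q = (L, 0) then 1 else 0)"
  "Poly_Mapping.lookup (state_mono M L q) (2, 0) = (if q = (0, 0) \<or> q = (L, 0) then 0 else prod_encode q)"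
  "Poly_Mapping.lookup (state_mono M L q) (3, 0) = (if q = (0, 0) \<or> q = (L, 0) then 0 else M - prod_encode q)"
  by (auto simp: state_mono_def lookup_add lookup_single)

lemma state_encoding_state_mono:
  assumes "L > 0"
  shows "state_encoding {q. prod_encode q \<le> M} (state_mono M L)"
proof
  fix v q assume "v \<in> Poly_Mapping.keys (state_mono M L q)"
  then show "fst v < 4 \<and> snd v = 0"
    by (auto simp: state_mono_def in_keys_iff lookup_add lookup_single when_def split: if_splits)
next
  fix q q' assume Q: "q \<in> {q. prod_encode q \<le> M}" "q' \<in> {q. prod_encode q \<le> M}"
    and le: "\<And>v. Poly_Mapping.lookup (state_mono M L q) v \<le> Poly_Mapping.lookup (state_mono M L q') v"
  note le' = le[of "(0, 0)"] le[of "(1, 0)"] le[of "(2, 0)"] le[of "(3, 0)"]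
  consider "q = (0, 0)" | "q \<noteq> (0, 0)" "q = (L, 0)" | "q \<noteq> (0, 0)" "q \<noteq> (L, 0)" by blast
  then show "q = q'"
  proof cases
    case 3
    \<comment> \<open>Only \<open>(0, 0)\<close> has code 0, so outside the two special states the
      exponent of constant 2 is positive, and no special monomial can be a multiple.\<close>
    then have pos: "prod_encode q > 0" using prod_encode_0[of q] by simp
    have le2: "prod_encode q \<le> (if q' = (0, 0) \<or> q' = (L, 0) then 0 else prod_encode q')"
      using le'(3) 3 unfolding lookup_state_mono by simp
    have "\<not> (q' = (0, 0) \<or> q' = (L, 0))"
    proof
      assume "q' = (0, 0) \<or> q' = (L, 0)"
      then show False using le2 pos by simp
    qed
    then have "prod_encode q \<le> prod_encode q'" "M - prod_encode q \<le> M - prod_encode q'"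
      using le2 le'(4) 3 unfolding lookup_state_mono by simp_all
    then have "prod_encode q = prod_encode q'" using Q unfolding mem_Collect_eq by linarith
    then show ?thesis by simp
  next
    case 1
    then show ?thesis using le'(1) unfolding lookup_state_mono by (simp split: if_splits)
  next
    case 2
    then show ?thesis using le'(2) unfolding lookup_state_mono by (simp split: if_splits)
  qed
qed

section \<open>Coding of differential polynomials\<close>

text \<open>Codes reach only coefficients from the image of the integers. The generators qualify,
  being single variables or differences of two monomials.\<close>

definition codable :: "'a::comm_ring_1 dpoly \<Rightarrow> bool" where
  "codable p \<longleftrightarrow> (\<exists>c. decode_dpoly c = p)"

lemma decode_theta_surj: "\<exists>c. decode_theta c = \<theta>"
proof -
  obtain N where N: "Poly_Mapping.keys \<theta> \<subseteq> {..<N}"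
    using finite_nat_iff_bounded finite_keys by blast
  let ?js = "map (Poly_Mapping.lookup \<theta>) [0..<N]"
  have "(\<Sum>l<N. Poly_Mapping.single l (?js ! l)) = \<theta>"
  proof (rule poly_mapping_eqI)
    fix k
    have "(\<Sum>l<N. Poly_Mapping.lookup (Poly_Mapping.single l (?js ! l)) k)
        = (\<Sum>l<N. if l = k then Poly_Mapping.lookup \<theta> k else 0)"
      by (rule sum.cong) (auto simp: lookup_single when_def)
    also have "\<dots> = Poly_Mapping.lookup \<theta> k"
      using N by (auto simp: in_keys_iff)
    finally show "Poly_Mapping.lookup (\<Sum>l<N. Poly_Mapping.single l (?js ! l)) k = Poly_Mapping.lookup \<theta> k"
      by (simp add: lookup_sum)
  qed
  then have "decode_theta (list_encode ?js) = \<theta>"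
    by (simp add: decode_theta_def Let_def)
  then show ?thesis by blast
qed

lemma decode_var_surj: "\<exists>c. decode_var c = v"
proof -
  obtain d where "decode_theta d = snd v" using decode_theta_surj by blast
  then have "decode_var (prod_encode (fst v, d)) = v" by (simp add: decode_var_def)
  then show ?thesis by blast
qed

lemma decode_mono_surj: "\<exists>c. decode_mono c = t"
proof (induction t rule: poly_mapping_single_induct)
  case zero
  have "decode_mono (list_encode []) = 0" unfolding decode_mono_def list_encode_inverse by simp
  then show ?case by blast
next
  case (single p t c)
  then obtain d u where "decode_mono d = p" "decode_var u = t" using decode_var_surj by blast
  then have "decode_mono (list_encode (prod_encode (u, c) # list_decode d)) = Poly_Mapping.single t c + p"
    unfolding decode_mono_def list_encode_inverse by simp
  then show ?case by blast
qed

lemma codable_single: "codable (Poly_Mapping.single t (of_int z))"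
proof -
  obtain d where "decode_mono d = t" using decode_mono_surj by blast
  then have "decode_dpoly (list_encode [prod_encode (int_encode z, d)]) = Poly_Mapping.single t (of_int z)"
    unfolding decode_dpoly_def list_encode_inverse by simp
  then show ?thesis unfolding codable_def by blast
qed

lemma codable_add: "codable p \<Longrightarrow> codable q \<Longrightarrow> codable (p + q)"
proof -
  assume "codable p" "codable q"
  then obtain c d where "decode_dpoly c = p" "decode_dpoly d = q" unfolding codable_def by blast
  then have "decode_dpoly (list_encode (list_decode c @ list_decode d)) = p + q"
    unfolding decode_dpoly_def list_encode_inverse by simp
  then show ?thesis unfolding codable_def by blast
qed

lemma codable_dv: "codable (dv v)"
  using codable_single[of _ 1] by (simp add: dv_def)

lemma codable_binomial: "codable (Poly_Mapping.single t 1 - Poly_Mapping.single u 1)"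
  using codable_add[OF codable_single[of t 1] codable_single[of u "- 1"]]
  by (simp add: single_uminus)

lemma codable_set:
  assumes "finite F" "\<And>p. p \<in> F \<Longrightarrow> codable p"
  shows "\<exists>y. decode_dpoly ` set (list_decode y) = F"
proof -
  obtain ps where ps: "set ps = F" using assms(1) finite_list by blast
  obtain c where "\<And>p. p \<in> F \<Longrightarrow> decode_dpoly (c p) = p" using assms(2) unfolding codable_def by metis
  then have "decode_dpoly ` set (list_decode (list_encode (map c ps))) = F"
    using ps by (force simp: image_image)
  then show ?thesis by blast
qed

context state_encoding
begin

lemma codable_rule_poly: "codable (rule_poly r e f :: 'a::comm_ring_1 dpoly)"
proof -
  obtain s a b t c d where sr: "src r = (s, a, b)" "tgt r = (t, c, d)" by (metis prod_cases3)
  define g where "g = (if free0 r then 0 else Poly_Mapping.single (w0 0) 1) +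
    (if free1 r then 0 else Poly_Mapping.single (w1 0) (1::nat))"
  have "gate0 r * gate1 r = Poly_Mapping.single g (1::'a)"
    by (simp add: gate0_def gate1_def g_def dv_def mult_single)
  then show ?thesis
    by (simp add: rule_poly_def sr dv_def mult_single right_diff_distrib codable_binomial)
qed

lemma finite_gens: "finite Rs \<Longrightarrow> finite (gens m Rs)"
  by (simp add: gens_def constants_gens_def)

lemma codable_gens: "p \<in> gens m Rs \<Longrightarrow> codable p"
  by (auto simp: gens_def constants_gens_def codable_dv codable_rule_poly)

end

text \<open>For the generators any code will do, but the query varies with \<open>x\<close>, so its
  code is written out in order to be computable. The code 0 decodes to the trivial derivative
  operator.\<close>

definition conf_code :: "nat \<Rightarrow> nat \<Rightarrow> nat" where
  "conf_code i X = list_encode [prod_encode (prod_encode (i, 0), 1), prod_encode (prod_encode (4, 0), 1),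
     prod_encode (prod_encode (5, 0), 1), prod_encode (prod_encode (6, list_encode [X]), 1)]"

lemma decode_conf_code:
  "decode_mono (conf_code i X) = Poly_Mapping.single (w0 0) 1 + Poly_Mapping.single (w1 0) 1 +
     (Poly_Mapping.single (i, 0) 1 + Poly_Mapping.single (xv X 0) 1)"
proof -
  have "decode_var (prod_encode (i, 0)) = (i, 0)" for i
    by (simp add: decode_var_def decode_theta_def Let_def)
  moreover have "decode_var (prod_encode (6, list_encode [X])) = xv X 0"
    unfolding decode_var_def decode_theta_def Let_def prod_encode_inverse snd_conv fst_conv list_encode_inverse
    by (simp add: xv_def)
  ultimately show ?thesis
    unfolding conf_code_def decode_mono_def list_encode_inverse by (simp add: w0_def w1_def add_ac)
qed

text \<open>The start configuration minus the accepting one. Their states have monomials independent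
  of the program, so the query does not depend on the set being decided.\<close>

definition query_code :: "nat \<Rightarrow> nat" where
  "query_code x = list_encode [prod_encode (int_encode 1, conf_code 0 (2 ^ x)),
     prod_encode (int_encode (- 1), conf_code 1 (reg_prime 1))]"

lemma (in state_encoding) decode_query_code:
  assumes "st q = Poly_Mapping.single (0, 0) 1" "st q' = Poly_Mapping.single (1, 0) 1"
  shows "decode_dpoly (query_code x) = conf_poly (q, 2 ^ x, 0) - conf_poly (q', reg_prime 1, 0)"
  unfolding query_code_def decode_dpoly_def list_encode_inverse
  by (simp add: decode_conf_code conf_poly_def assms dv_def mult_single single_uminus)

text \<open>The code \<open>y\<close> depends on the decided set, the query only on
  \<open>x\<close>, so every decidable set is a section of the membership problem. Diagonalization
  requires this uniformity.\<close>

theorem representing_generators: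
  assumes "m \<ge> 2" "(1::'a::comm_ring_1) \<noteq> 0" "\<And>x. eval_recf f [x] (if x \<in> A then 1 else 0)"
  shows "\<exists>y. \<forall>x. prod_encode (query_code x, y) \<in> membership_problem TYPE('a) 7 m \<longleftrightarrow> x \<in> A"
proof -
  obtain P where P: "P \<noteq> []"
      and run: "\<And>x. (collatz_step P)\<^sup>*\<^sup>* (0, 2 ^ x) (length P, if x \<in> A then reg_prime 1 else 1)"
    using collatz_simulation[OF assms(3)] by blast
  define Rs where "Rs = collatz_rules P"
  let ?L = "length P" and ?step = "rule_step Rs"
  let ?halt = "\<lambda>h. ((?L, 0), h, 0) :: (nat \<times> nat) \<times> nat \<times> nat"
  have fin: "finite Rs" by (simp add: Rs_def finite_collatz_rules)
  have det: "?step c d \<Longrightarrow> ?step c d' \<Longrightarrow> d = d'" for c d d'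
    unfolding Rs_def by (rule rule_step_collatz_det)
  have stuck: "\<not> ?step (?halt h) d" for h d unfolding Rs_def by (rule rule_step_collatz_stuck)
  have steps: "?step\<^sup>*\<^sup>* ((0, 0), 2 ^ x, 0) (?halt (if x \<in> A then reg_prime 1 else 1))" for x
    unfolding Rs_def using collatz_steps_rules[OF run[of x]] by simp
  \<comment> \<open>The states that occur in rules, with the initial and the final one. The bound
    \<open>M\<close> on their codes becomes the common exponent sum of the ordinary state
    monomials.\<close>
  define Q0 where "Q0 = insert (0, 0) (insert (?L, 0) ((fst \<circ> src) ` Rs \<union> (fst \<circ> tgt) ` Rs))"
  define M where "M = Max (prod_encode ` Q0)"
  have Q0: "prod_encode q \<le> M" if "q \<in> Q0" for q
    unfolding M_def using that fin by (intro Max_ge) (auto simp: Q0_def)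
  interpret state_encoding "{q. prod_encode q \<le> M}" "state_mono M ?L"
    using P by (intro state_encoding_state_mono) simp
  have rules: "rules_in Rs" unfolding rules_in_def using Q0 by (auto simp: Q0_def)
  obtain y where y: "decode_dpoly ` set (list_decode y) = (gens m Rs :: 'a dpoly set)"
    using codable_set[OF finite_gens[OF fin], of m] codable_gens[of _ m Rs] by blast
  \<comment> \<open>As \<open>P\<close> is not empty, the halting state differs from
    \<open>(0, 0)\<close> and is encoded by indeterminate 1.\<close>
  have q: "decode_dpoly (query_code x) =
      conf_poly ((0, 0), 2 ^ x, 0) - (conf_poly (?halt (reg_prime 1)) :: 'a dpoly)" for x
    using P by (intro decode_query_code) (simp_all add: state_mono_def)
  have "prod_encode (query_code x, y) \<in> membership_problem TYPE('a) 7 m \<longleftrightarrow>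
      conf_poly ((0, 0), 2 ^ x, 0) - conf_poly (?halt (reg_prime 1)) \<in> diff_ideal_gen 7 m (gens m Rs :: 'a dpoly set)" for x
  proof -
    have "(gens m Rs :: 'a dpoly set) \<subseteq> dpolys 7 m" using assms(1) by (rule dpolys_gens)
    moreover have "conf_poly c - conf_poly c' \<in> (dpolys 7 m :: 'a dpoly set)" for c c'
      by (intro dpolys_diff dpolys_conf assms(1))
    ultimately show ?thesis unfolding membership_problem_def by (simp add: y q Let_def)
  qed
  moreover have "conf_poly ((0, 0), 2 ^ x, 0) - conf_poly (?halt (reg_prime 1)) \<in> diff_ideal_gen 7 m (gens m Rs :: 'a dpoly set)
      \<longleftrightarrow> x \<in> A" for x
  proof
    assume "x \<in> A"
    then show "conf_poly ((0, 0), 2 ^ x, 0) - conf_poly (?halt (reg_prime 1)) \<in> diff_ideal_gen 7 m (gens m Rs :: 'a dpoly set)"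
      using rule_steps_gen[OF assms(1) steps[of x]] by simp
  next
    assume mem: "conf_poly ((0, 0), 2 ^ x, 0) - conf_poly (?halt (reg_prime 1)) \<in> diff_ideal_gen 7 m (gens m Rs :: 'a dpoly set)"
    \<comment> \<open>Indicator of reaching the accepting configuration; its two values in the
      coefficient ring are distinct by assumption.\<close>
    define \<chi> :: "(nat \<times> nat) \<times> nat \<times> nat \<Rightarrow> 'a" where
      "\<chi> c = (if ?step\<^sup>*\<^sup>* c (?halt (reg_prime 1)) then 1 else 0)" for c
    have "\<chi> c = \<chi> c'" if "?step c c'" for c c'
      unfolding \<chi>_def using deterministic_reach_iff[of ?step, OF det that stuck] by simp
    from gen_invariant[OF assms(1) rules this _ _ mem]
    have "\<chi> ((0, 0), 2 ^ x, 0) = \<chi> (?halt (reg_prime 1))" using Q0 by (simp add: Q0_def)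
    then have "?step\<^sup>*\<^sup>* ((0, 0), 2 ^ x, 0) (?halt (reg_prime 1))"
      using assms(2) by (auto simp: \<chi>_def split: if_splits)
    \<comment> \<open>The actual run also ends in a stuck configuration, so by determinism its final
      number is \<open>reg_prime 1\<close> and not 1.\<close>
    from deterministic_stuck_unique[of ?step, OF det this steps[of x] stuck stuck]
    show "x \<in> A" using reg_prime_gt_1[of 1] by (auto split: if_splits)
  qed
  ultimately show ?thesis by blast
qed

section \<open>Diagonalization\<close>

lemma eval_Comp1: "eval_recf g xs a \<Longrightarrow> eval_recf f [a] z \<Longrightarrow> eval_recf (Comp f [g]) xs z"
  by (rule eval_recf.intros(4)[of "[a]"]) auto

lemma eval_Comp2:
  "eval_recf g xs a \<Longrightarrow> eval_recf h xs b \<Longrightarrow> eval_recf f [a, b] z \<Longrightarrow> eval_recf (Comp f [g, h]) xs z"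
  by (rule eval_recf.intros(4)[of "[a, b]"]) (auto simp: less_Suc_eq)

lemma eval_Proj: "i < length xs \<Longrightarrow> xs ! i = z \<Longrightarrow> eval_recf (Proj i) xs z"
  using eval_recf.intros(3) by blast

section \<open>Computability of the query map\<close>

definition add_recf :: recf where "add_recf = PrimRec (Proj 0) (Comp Succ [Proj 1])"

lemma eval_add_recf: "eval_recf add_recf [a, b] (a + b)"
  unfolding add_recf_def
proof (induction a)
  case 0
  have "eval_recf (Proj 0) [b] b" by (rule eval_Proj) auto
  then show ?case by (simp add: eval_recf.intros(5))
next
  case (Suc a)
  have "eval_recf (Comp Succ [Proj 1]) [a, a + b, b] (Suc (a + b))"
    by (rule eval_Comp1[OF eval_Proj eval_recf.intros(2)]) auto
  from eval_recf.intros(6)[OF Suc this] show ?case by simp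
qed

definition triangle_recf :: recf where
  "triangle_recf = PrimRec Zero (Comp add_recf [Proj 1, Comp Succ [Proj 0]])"

lemma eval_triangle_recf: "eval_recf triangle_recf [a] (triangle a)"
  unfolding triangle_recf_def
proof (induction a)
  case (Suc a)
  have "eval_recf (Comp add_recf [Proj 1, Comp Succ [Proj 0]]) [a, triangle a] (triangle a + Suc a)"
    by (intro eval_Comp2[OF _ _ eval_add_recf] eval_Comp1[OF _ eval_recf.intros(2)] eval_Proj) auto
  from eval_recf.intros(6)[OF Suc this] show ?case by simp
qed (simp add: eval_recf.intros(1,5))

definition power2_recf :: recf where
  "power2_recf = PrimRec (Comp Succ [Zero]) (Comp add_recf [Proj 1, Proj 1])"

lemma eval_power2_recf: "eval_recf power2_recf [a] (2 ^ a)"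
  unfolding power2_recf_def
proof (induction a)
  case 0
  have "eval_recf (Comp Succ [Zero]) [] 1"
    using eval_Comp1[OF eval_recf.intros(1) eval_recf.intros(2)] by simp
  then show ?case by (simp add: eval_recf.intros(5))
next
  case (Suc a)
  have "eval_recf (Comp add_recf [Proj 1, Proj 1]) [a, 2 ^ a] (2 ^ a + 2 ^ a)"
    by (intro eval_Comp2[OF _ _ eval_add_recf] eval_Proj) auto
  from eval_recf.intros(6)[OF Suc this] show ?case by (simp add: mult_2)
qed

definition computable :: "(nat \<Rightarrow> nat) \<Rightarrow> bool" where
  "computable F \<longleftrightarrow> (\<exists>f. \<forall>x. eval_recf f [x] (F x))"

lemma computable_comp: "computable F \<Longrightarrow> computable G \<Longrightarrow> computable (\<lambda>x. F (G x))"
  unfolding computable_def by (meson eval_Comp1)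

lemma computable_id: "computable (\<lambda>x. x)"
  unfolding computable_def using eval_Proj[of 0 "[_]"] by auto

lemma computable_Suc: "computable F \<Longrightarrow> computable (\<lambda>x. Suc (F x))"
  by (rule computable_comp[of Suc]) (auto simp: computable_def intro: eval_recf.intros(2))

lemma computable_const: "computable (\<lambda>x. c)"
proof (induction c)
  case 0
  show ?case unfolding computable_def using eval_recf.intros(1) by blast
qed (rule computable_Suc)

lemma computable_prod_encode:
  assumes "computable F" "computable G"
  shows "computable (\<lambda>x. prod_encode (F x, G x))"
proof -
  obtain f g where "\<And>x. eval_recf f [x] (F x)" "\<And>x. eval_recf g [x] (G x)"
    using assms unfolding computable_def by blast
  then have "eval_recf (Comp add_recf [Comp triangle_recf [Comp add_recf [f, g]], f]) [x] (prod_encode (F x, G x))" for x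
    unfolding prod_encode_def prod.case
    by (intro eval_Comp2[OF _ _ eval_add_recf] eval_Comp1[OF _ eval_triangle_recf])
  then show ?thesis unfolding computable_def by blast
qed

lemma computable_query_code: "computable query_code"
proof -
  have "computable (\<lambda>x. 2 ^ x)" unfolding computable_def using eval_power2_recf by blast
  then show ?thesis
    unfolding query_code_def conf_code_def list_encode.simps
    by (intro computable_Suc computable_prod_encode computable_const)
qed

lemma computable_diagonal_complement:
  assumes "decidable_set B" "computable G"
  shows "\<exists>f. \<forall>x. eval_recf f [x] (if x \<in> {x. G x \<notin> B} then 1 else 0)"
proof -
  obtain f g where f: "\<And>x. eval_recf f [x] (if x \<in> B then 1 else 0)"
    and g: "\<And>x. eval_recf g [x] (G x)"
    using assms unfolding decidable_set_def computable_def by blast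
  let ?not = "PrimRec (Comp Succ [Zero]) Zero"
  have zero: "eval_recf ?not [0] 1"
    using eval_recf.intros(5)[OF eval_Comp1[OF eval_recf.intros(1) eval_recf.intros(2)]] by simp
  then have one: "eval_recf ?not [1] 0"
    using eval_recf.intros(6)[OF _ eval_recf.intros(1)] by (metis One_nat_def)
  have "eval_recf (Comp ?not [Comp f [g]]) [x] (if x \<in> {x. G x \<notin> B} then 1 else 0)" for x
    using eval_Comp1[OF eval_Comp1[OF g f]] zero one by simp
  then show ?thesis by blast
qed

theorem theorem1:
  fixes m :: nat
  assumes "(1::'a::comm_ring_1) \<noteq> 0"
    and "m \<ge> 2"
  shows "\<exists>n. \<not> decidable_set (membership_problem TYPE('a) n m)"
proof (intro exI notI)
  \<comment> \<open>Four indeterminates for states, two gates and \<open>x\<close> make seven,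
    whatever \<open>m\<close> is.\<close>
  assume dec: "decidable_set (membership_problem TYPE('a) 7 m)"
  have "computable (\<lambda>x. prod_encode (query_code x, x))"
    by (intro computable_prod_encode computable_query_code computable_id)
  from computable_diagonal_complement[OF dec this] obtain f where
    "\<And>x. eval_recf f [x] (if x \<in> {x. prod_encode (query_code x, x) \<notin> membership_problem TYPE('a) 7 m} then 1 else 0)"
    by blast
  from representing_generators[OF assms(2,1) this] obtain y where
    "\<And>x. prod_encode (query_code x, y) \<in> membership_problem TYPE('a) 7 m \<longleftrightarrow>
      prod_encode (query_code x, x) \<notin> membership_problem TYPE('a) 7 m"
    by blast
  from this[of y] show False by blast
qed

end
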